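(* Let $a>0$ and let $x^\dagger\in X_p$ for some $0<p<1$, but $x^\dagger\notin X_1$. Assume: (1) $F:\mathcal D(F)\subseteq X\to Y$ is weak-to-weak sequentially continuous, $\mathcal D(F)$ is a convex and closed subset of $X$, and $x^\dagger\in\mathcal D(F)$ is the uniquely determined solution of $F(x)=y$. (2) $x^\dagger$ is an interior point of $\mathcal D(F)$, with $r>0$ such that $\mathcal B^X_r(x^\dagger)\subset\mathcal D(F)$, and there are constants $0<\underline K\le\overline K<\infty$ such that $$\underline K\,\|x-x^\dagger\|_{-a}\le\|F(x)-F(x^\dagger)\|_Y\quad\text{for all }x\in\mathcal D(F)\cap X_1$$ and $$\|F(x)-F(x^\dagger)\|_Y\le\overline K\,\|x-x^\dagger\|_{-a}\quad\text{for all }x\in\mathcal B^X_r(x^\dagger)\cap X_1 .$$ Then, if the regularization parameter is chosen a priori as $$\alpha_*=\alpha(\delta)=\delta^{\,2-2\frac{p-1}{p+a}},$$ the regularized solutions satisfy $$\|x_{\alpha_*}^\delta-x^\dagger\|_X=\mathcal O\left(\delta^{\frac{p}{p+a}}\right)\quad\text{as }\delta\to0 .$$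
   Context: $X$ and $Y$ are infinite-dimensional real Hilbert spaces with norms $\|\cdot\|_X,\|\cdot\|_Y$, and $F:\mathcal D(F)\subseteq X\to Y$ is a (nonlinear) operator. $\mathcal B^X_r(\bar x)$ denotes the closed ball in $X$ with center $\bar x$ and radius $r$. $B:\mathcal D(B)\subset X\to X$ is a densely defined, unbounded, linear, self-adjoint operator that is strictly positive, with $\|Bx\|_X\ge c_B\|x\|_X$ for all $x\in\mathcal D(B)$ and some constant $c_B>0$. It generates the Hilbert scale $\{X_\nu\}_{\nu\in\mathbb R}$, $X_\nu=\mathcal D(B^\nu)$, with norm $\|x\|_\nu:=\|B^\nu x\|_X$; in particular $X_0=X$, $X_1=\mathcal D(B)$, and $\|x\|_{-a}=\|B^{-a}x\|_X$ for $x\in X$, $a>0$. It is assumed that $\mathcal D(F)\cap\mathcal D(B)\neq\emptyset$. The exact data are $y=F(x^\dagger)$. For noise level $\delta>0$, the noisy data $y^\delta\in Y$ satisfy $\|y-y^\delta\|_Y\le\delta$. For $\alpha>0$, the regularized solution $x_\alpha^\delta$ denotes a global minimizer over $x\in\mathcal D(F)$ of the Tikhonov functional $$T_\alpha^\delta(x)=\|F(x)-y^\delta\|_Y^2+\alpha\|Bx\|_X^2,$$ with $T_\alpha^\delta(x):=+\infty$ if $x\notin\mathcal D(B)$. The $\mathcal O$-statement means: there are constants $C,\bar\delta>0$ such that for all $0<\delta\le\bar\delta$, all $y^\delta$ with $\|y-y^\delta\|_Y\le\delta$, and all corresponding minimizers, the left-hand side is at most $C$ times the stated power of $\delta$. 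*)

theory Defs
  imports "HOL-Analysis.Analysis"
begin

definition infinite_dimensional :: "'a::real_vector itself \<Rightarrow> bool" where
  "infinite_dimensional _ \<longleftrightarrow> (\<nexists>S::'a set. finite S \<and> span S = UNIV)"

definition weakly_converges :: "(nat \<Rightarrow> 'a::real_normed_vector) \<Rightarrow> 'a \<Rightarrow> bool" where
  "weakly_converges u x \<longleftrightarrow>
     (\<forall>\<phi> :: 'a \<Rightarrow> real. bounded_linear \<phi> \<longrightarrow> (\<lambda>n. \<phi> (u n)) \<longlonglongrightarrow> \<phi> x)"

definition weak_seq_continuous_on ::
  "'a::real_normed_vector set \<Rightarrow> ('a \<Rightarrow> 'b::real_normed_vector) \<Rightarrow> bool" where
  "weak_seq_continuous_on S F \<longleftrightarrow>
     (\<forall>u x. range u \<subseteq> S \<longrightarrow> x \<in> S \<longrightarrow> weakly_converges u x \<longrightarrow> weakly_converges (F \<circ> u) (F x))"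

text \<open>An unbounded operator is a pair of a domain D and a total function B; the values
  of B outside D are irrelevant.\<close>

definition linear_operator_on ::
  "'a::real_vector set \<Rightarrow> ('a \<Rightarrow> 'b::real_vector) \<Rightarrow> bool" where
  "linear_operator_on D B \<longleftrightarrow> subspace D \<and>
     (\<forall>x\<in>D. \<forall>y\<in>D. B (x + y) = B x + B y) \<and> (\<forall>c. \<forall>x\<in>D. B (c *\<^sub>R x) = c *\<^sub>R B x)"

definition unbounded_on ::
  "'a::real_normed_vector set \<Rightarrow> ('a \<Rightarrow> 'b::real_normed_vector) \<Rightarrow> bool" where
  "unbounded_on D B \<longleftrightarrow> (\<nexists>M. \<forall>x\<in>D. norm (B x) \<le> M * norm x)"

text \<open>The left-hand side of the inner equivalence says that y lies in the domain of the
  adjoint of B and is mapped to z by it, so B and its adjoint have the same graph.\<close>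

definition self_adjoint_on :: "'a::real_inner set \<Rightarrow> ('a \<Rightarrow> 'a) \<Rightarrow> bool" where
  "self_adjoint_on D B \<longleftrightarrow> linear_operator_on D B \<and> closure D = UNIV \<and>
     (\<forall>y z. (\<forall>x\<in>D. inner (B x) y = inner x z) \<longleftrightarrow> y \<in> D \<and> z = B y)"

definition strictly_positive_on :: "'a::real_inner set \<Rightarrow> ('a \<Rightarrow> 'a) \<Rightarrow> bool" where
  "strictly_positive_on D B \<longleftrightarrow> (\<forall>x\<in>D. x \<noteq> 0 \<longrightarrow> 0 < inner (B x) x)"

definition orthogonal_projection :: "('a::real_inner \<Rightarrow> 'a) \<Rightarrow> bool" where
  "orthogonal_projection P \<longleftrightarrow> linear P \<and> (\<forall>x. P (P x) = P x) \<and>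
     (\<forall>x y. inner (P x) y = inner x (P y))"

definition projection_valued_measure :: "(real set \<Rightarrow> 'a::real_inner \<Rightarrow> 'a) \<Rightarrow> bool" where
  "projection_valued_measure E \<longleftrightarrow>
     (\<forall>S\<in>sets borel. orthogonal_projection (E S)) \<and>
     E UNIV = id \<and>
     (\<forall>S\<in>sets borel. \<forall>T\<in>sets borel. E (S \<inter> T) = E S \<circ> E T) \<and>
     (\<forall>A::nat \<Rightarrow> real set. range A \<subseteq> sets borel \<longrightarrow> disjoint_family A \<longrightarrow>
        (\<forall>x. (\<lambda>n. E (A n) x) sums E (\<Union>n. A n) x))"

definition scalar_spectral_measure ::
  "(real set \<Rightarrow> 'a::real_inner \<Rightarrow> 'a) \<Rightarrow> 'a \<Rightarrow> real measure" where
  "scalar_spectral_measure E x =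
     measure_of UNIV (sets borel) (\<lambda>S. ennreal (inner (E S x) x))"

text \<open>The relation below says that x lies in the domain of the spectral integral of f and that
  z is its value at x.  The value is characterised weakly, with the integral of f against the
  signed measure \<open>S \<mapsto> \<langle>E S x, y\<rangle>\<close> written by polarization.  The test
  vectors y range over the domain of the spectral integral only (a dense subspace), which
  makes f integrable with respect to the scalar measures of x + y and x - y.\<close>

definition in_spectral_domain ::
  "(real set \<Rightarrow> 'a::real_inner \<Rightarrow> 'a) \<Rightarrow> (real \<Rightarrow> real) \<Rightarrow> 'a \<Rightarrow> bool" where
  "in_spectral_domain E f x \<longleftrightarrow> integrable (scalar_spectral_measure E x) (\<lambda>t. (f t)\<^sup>2)"

definition has_spectral_integral ::
  "(real set \<Rightarrow> 'a::real_inner \<Rightarrow> 'a) \<Rightarrow> (real \<Rightarrow> real) \<Rightarrow> 'a \<Rightarrow> 'a \<Rightarrow> bool" where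
  "has_spectral_integral E f x z \<longleftrightarrow> in_spectral_domain E f x \<and>
     (\<forall>y. in_spectral_domain E f y \<longrightarrow>
        inner z y = ((LINT t|scalar_spectral_measure E (x + y). f t) -
                     (LINT t|scalar_spectral_measure E (x - y). f t)) / 4)"

definition spectral_measure_of ::
  "'a::real_inner set \<Rightarrow> ('a \<Rightarrow> 'a) \<Rightarrow> (real set \<Rightarrow> 'a \<Rightarrow> 'a) \<Rightarrow> bool" where
  "spectral_measure_of D B E \<longleftrightarrow> projection_valued_measure E \<and>
     (\<forall>x z. has_spectral_integral E (\<lambda>t. t) x z \<longleftrightarrow> x \<in> D \<and> z = B x)"

text \<open>The graph of the power of B with exponent \<open>\<nu>\<close>, by functional calculus.  By the
  spectral theorem a self-adjoint B has exactly one spectral measure (up to its irrelevant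
  values on non-Borel sets).  For strictly positive B that measure is carried by the positive
  half-line, so the values of powr at nonpositive arguments play no role.\<close>

definition operator_power ::
  "'a::real_inner set \<Rightarrow> ('a \<Rightarrow> 'a) \<Rightarrow> real \<Rightarrow> 'a \<Rightarrow> 'a \<Rightarrow> bool" where
  "operator_power D B \<nu> x z \<longleftrightarrow>
     (\<exists>E. spectral_measure_of D B E \<and> has_spectral_integral E (\<lambda>t. t powr \<nu>) x z)"

definition hilbert_scale :: "'a::real_inner set \<Rightarrow> ('a \<Rightarrow> 'a) \<Rightarrow> real \<Rightarrow> 'a set" where
  "hilbert_scale D B \<nu> = {x. \<exists>z. operator_power D B \<nu> x z}"

definition scale_norm :: "'a::real_inner set \<Rightarrow> ('a \<Rightarrow> 'a) \<Rightarrow> real \<Rightarrow> 'a \<Rightarrow> real" where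
  "scale_norm D B \<nu> x = norm (THE z. operator_power D B \<nu> x z)"

definition tikhonov ::
  "'x::real_inner set \<Rightarrow> ('x \<Rightarrow> 'x) \<Rightarrow> ('x \<Rightarrow> 'y::real_inner) \<Rightarrow> 'y \<Rightarrow> real \<Rightarrow> 'x \<Rightarrow> ereal"
  where
  "tikhonov D B F y\<delta> \<alpha> x =
     (if x \<in> D then ereal ((norm (F x - y\<delta>))\<^sup>2 + \<alpha> * (norm (B x))\<^sup>2) else \<infinity>)"

definition regularized_solution ::
  "'x::real_inner set \<Rightarrow> ('x \<Rightarrow> 'x) \<Rightarrow> 'x set \<Rightarrow> ('x \<Rightarrow> 'y::real_inner) \<Rightarrow> 'y \<Rightarrow> real \<Rightarrow> 'x \<Rightarrow> bool"
  where
  "regularized_solution D B DF F y\<delta> \<alpha> x \<longleftrightarrow>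
     is_arg_min (tikhonov D B F y\<delta> \<alpha>) (\<lambda>x. x \<in> DF) x"

end

theory Submission
  imports Defs
begin

text \<open>
  The proof compares the regularized solution with a spectral cut-off of the exact one.  Let
  \<open>\<mu> x\<close> be the scalar spectral measure of \<open>x\<close>, so that \<open>\<parallel>x\<parallel>\<^sub>\<nu>\<^sup>2\<close> is the integral of
  \<open>t powr (2 * \<nu>)\<close> against \<open>\<mu> x\<close>.  Put \<open>\<kappa> = \<delta> powr (- 1 / (p + a))\<close> and let
  \<open>x\<^sub>\<kappa>\<close> be the part of \<open>xd\<close> with spectrum in \<open>{0..\<kappa>}\<close>.  Since \<open>xd\<close> has a finite \<open>p\<close>-norm,
  \<open>\<parallel>x\<^sub>\<kappa> - xd\<parallel>\<close> is of order \<open>\<kappa> powr (- p) = \<delta> powr (p / (p + a))\<close>, the distance in the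
  \<open>(- a)\<close>-norm is of order \<open>\<kappa> powr (- (p + a)) = \<delta>\<close>, and \<open>\<parallel>B x\<^sub>\<kappa>\<parallel>\<close> is of order
  \<open>\<kappa> powr (1 - p)\<close>.  The parameter choice balances the two terms of the Tikhonov functional: its
  value at \<open>x\<^sub>\<kappa>\<close>, hence its minimum, is of order \<open>\<delta>\<^sup>2\<close>.  For the minimizer \<open>x\<close> this bounds
  \<open>\<parallel>B x\<parallel>\<close> by a multiple of \<open>\<kappa> powr (1 - p)\<close> and, through the lower estimate for \<open>F\<close>, the
  \<open>(- a)\<close>-norm of \<open>x - xd\<close> by a multiple of \<open>\<delta>\<close>.  The same bounds hold for \<open>x - x\<^sub>\<kappa>\<close>, and
  interpolation between the \<open>(- a)\<close>-norm and the \<open>1\<close>-norm (\<open>interpolation_inequality\<close>) gives the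
  rate for \<open>\<parallel>x - x\<^sub>\<kappa>\<parallel>\<close>.  This argument is \<open>tikhonov_error_le\<close>.

  The rest of the theory turns the powers of \<open>B\<close>, which are only given as a relation, into such
  integrals, for the spectral measure \<open>E\<close> of \<open>B\<close> that comes with the hypothesis that \<open>xd\<close> lies in a
  Hilbert scale space.  This rests on two facts.  One is that spectral integrals exist as soon
  as the square of the integrand is integrable (\<open>spectral_integral_exists\<close>).  They are obtained
  by approximation with step functions, which
  \<open>f \<mapsto> (\<integral> f dE) x\<close> maps isometrically from \<open>L\<^sup>2\<close> of \<open>\<mu> x\<close> to the Hilbert space.
  The other is that the \<open>(- a)\<close>-norm, a definite description ranging over all spectral
  measures of \<open>B\<close>, is well defined (\<open>scale_norm_negative\<close>).  For this, \<open>B\<close> is shown to be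
  surjective; the moments of \<open>1 / t\<^sup>2\<close> under \<open>\<mu> u\<close> are then the squared norms of the iterated
  preimages of \<open>u\<close> under \<open>B\<close>, hence independent of \<open>E\<close>, and by the Weierstrass theorem so is the
  integral of every continuous function of \<open>1 / t\<^sup>2\<close>, in particular of \<open>t powr (- a)\<close>.
\<close>

section \<open>Finite Borel measures on the real line\<close>

lemma finite_range_as_sum_indicators:
  fixes s :: "'b \<Rightarrow> real"
  assumes "finite (range s)"
  shows "s t = (\<Sum>v\<in>range s. v * indicator (s -` {v}) t)"
proof -
  have "(\<Sum>v\<in>range s. v * indicator (s -` {v}) t) = (\<Sum>v\<in>range s. if v = s t then v else 0)"
    by (intro sum.cong) (auto simp: indicator_def)
  also have "\<dots> = s t" using assms by (subst sum.delta) auto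
  finally show ?thesis by simp
qed

lemma integral_finite_range:
  fixes s :: "real \<Rightarrow> real" and M :: "real measure"
  assumes "finite_measure M" "sets M = sets borel"
    and "finite (range s)" "s \<in> borel_measurable borel" "S \<in> sets borel"
  shows "(LINT t|M. indicator S t * s t) = (\<Sum>v\<in>range s. v * measure M (S \<inter> s -` {v}))"
proof -
  have sp: "space M = UNIV" using sets_eq_imp_space_eq[OF assms(2)] by simp
  have ms: "S \<inter> s -` {v} \<in> sets M" for v
    using measurable_sets[OF assms(4), of "{v}"] assms by auto
  have "(LINT t|M. indicator S t * s t) = (LINT t|M. (\<Sum>v\<in>range s. v * indicator (S \<inter> s -` {v}) t))"
    by (subst finite_range_as_sum_indicators[OF assms(3)])
       (simp add: sum_distrib_left indicator_inter_arith mult.left_commute)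
  also have "\<dots> = (\<Sum>v\<in>range s. LINT t|M. v * indicator (S \<inter> s -` {v}) t)"
    using ms by (intro Bochner_Integration.integral_sum integrable_mult_right integrable_real_indicator)
       (auto simp: finite_measure.emeasure_finite[OF assms(1)] top.not_eq_extremum[symmetric])
  also have "\<dots> = (\<Sum>v\<in>range s. v * measure M (S \<inter> s -` {v}))"
    using ms sp by simp
  finally show ?thesis .
qed

text \<open>The factor 2 gives a multiple of \<open>\<bar>f\<bar>\<close> as a majorant for dominated convergence.\<close>

lemma simple_approximation:
  fixes f :: "real \<Rightarrow> real"
  assumes f: "f \<in> borel_measurable borel"
  obtains s :: "nat \<Rightarrow> real \<Rightarrow> real" where
    "\<And>n. finite (range (s n))" "\<And>n. s n \<in> borel_measurable borel"
    "\<And>t. (\<lambda>n. s n t) \<longlonglongrightarrow> f t" "\<And>n t. \<bar>s n t\<bar> \<le> 2 * \<bar>f t\<bar>"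
proof -
  obtain s :: "nat \<Rightarrow> real \<Rightarrow> real" where s: "\<And>n. simple_function borel (s n)"
    "\<And>t. (\<lambda>n. s n t) \<longlonglongrightarrow> f t" "\<And>n t. dist (s n t) 0 \<le> 2 * dist (f t) 0"
    using borel_measurable_implies_sequence_metric[OF f, of 0] by auto
  show thesis
  proof (rule that)
    show "finite (range (s n))" for n using simple_functionD(1)[OF s(1)[of n]] by simp
    show "s n \<in> borel_measurable borel" for n using s(1) by (rule borel_measurable_simple_function)
  qed (use s in auto)
qed

text \<open>Identities between signed measures \<open>S \<mapsto> \<langle>E S x, y\<rangle>\<close> appear here as vanishing linear
  combinations of finite positive measures.  They pass to integrals because they do so for step
  functions.\<close>

lemma integral_linear_relation:
  fixes M :: "'i \<Rightarrow> real measure" and f :: "real \<Rightarrow> real"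
  assumes fin: "\<And>i. i \<in> I \<Longrightarrow> finite_measure (M i)" and sets: "\<And>i. i \<in> I \<Longrightarrow> sets (M i) = sets borel"
    and rel: "\<And>S. S \<in> sets borel \<Longrightarrow> (\<Sum>i\<in>I. c i * measure (M i) S) = 0"
    and int: "\<And>i. i \<in> I \<Longrightarrow> integrable (M i) f" and f: "f \<in> borel_measurable borel"
  shows "(\<Sum>i\<in>I. c i * (LINT t|M i. f t)) = 0"
proof -
  obtain s where s: "\<And>n. finite (range (s n))" "\<And>n. s n \<in> borel_measurable borel"
    "\<And>t. (\<lambda>n. s n t) \<longlonglongrightarrow> f t" "\<And>n t. \<bar>s n t\<bar> \<le> 2 * \<bar>f t\<bar>"
    using simple_approximation[OF f] by blast
  have lim: "(\<lambda>n. LINT t|M i. s n t) \<longlonglongrightarrow> (LINT t|M i. f t)" if "i \<in> I" for i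
  proof (rule integral_dominated_convergence[where w = "\<lambda>t. 2 * \<bar>f t\<bar>"])
    show "f \<in> borel_measurable (M i)" "s n \<in> borel_measurable (M i)" for n
      using f s(2) by (simp_all add: measurable_cong_sets[OF sets[OF that] refl])
    show "integrable (M i) (\<lambda>t. 2 * \<bar>f t\<bar>)" using int[OF that] by auto
  qed (use s in auto)
  have "(\<Sum>i\<in>I. c i * (LINT t|M i. s n t)) = 0" for n
  proof -
    have "(\<Sum>i\<in>I. c i * (LINT t|M i. s n t))
        = (\<Sum>i\<in>I. c i * (\<Sum>v\<in>range (s n). v * measure (M i) (s n -` {v})))"
      using integral_finite_range[OF fin sets s(1,2), of _ UNIV] by (intro sum.cong) auto
    also have "\<dots> = (\<Sum>v\<in>range (s n). v * (\<Sum>i\<in>I. c i * measure (M i) (s n -` {v})))"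
      by (simp only: sum_distrib_left, subst sum.swap) (simp add: mult.left_commute)
    also have "\<dots> = 0"
      using measurable_sets[OF s(2), of "{_}"] by (simp add: rel)
    finally show ?thesis .
  qed
  moreover have "(\<lambda>n. \<Sum>i\<in>I. c i * (LINT t|M i. s n t)) \<longlonglongrightarrow> (\<Sum>i\<in>I. c i * (LINT t|M i. f t))"
    by (intro tendsto_sum tendsto_mult tendsto_const lim)
  ultimately show ?thesis by (simp add: LIMSEQ_const_iff)
qed

text \<open>The instance that occurs below: polarization and the parallelogram law relate four measures.\<close>

lemma integral_four_measures:
  fixes f :: "real \<Rightarrow> real" and M1 M2 M3 M4 :: "real measure"
  assumes "finite_measure M1" "finite_measure M2" "finite_measure M3" "finite_measure M4"
    and "sets M1 = sets borel" "sets M2 = sets borel" "sets M3 = sets borel" "sets M4 = sets borel"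
    and "integrable M1 f" "integrable M2 f" "integrable M3 f" "integrable M4 f"
    and "f \<in> borel_measurable borel"
    and rel: "\<And>S. S \<in> sets borel \<Longrightarrow>
      c1 * measure M1 S + c2 * measure M2 S + c3 * measure M3 S + c4 * measure M4 S = 0"
  shows "c1 * (LINT t|M1. f t) + c2 * (LINT t|M2. f t) + c3 * (LINT t|M3. f t) + c4 * (LINT t|M4. f t) = 0"
proof -
  define M where "M i = [M1, M2, M3, M4] ! i" for i :: nat
  define c where "c i = [c1, c2, c3, c4] ! i" for i :: nat
  have M: "M 0 = M1" "M 1 = M2" "M 2 = M3" "M 3 = M4" and c: "c 0 = c1" "c 1 = c2" "c 2 = c3" "c 3 = c4"
    by (simp_all add: M_def c_def)
  have "(\<Sum>i\<in>{0, 1, 2, 3}. c i * (LINT t|M i. f t)) = 0"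
  proof (rule integral_linear_relation)
    show "(\<Sum>i\<in>{0, 1, 2, 3}. c i * measure (M i) S) = 0" if "S \<in> sets borel" for S
      using rel[OF that] M c by simp
  qed (use assms M in auto)
  then show ?thesis using M c by simp
qed

text \<open>Used to transfer integrability: a function integrable for two measures is integrable for every
  measure that is dominated setwise by a multiple of their sum.\<close>

lemma nn_integral_le_sum_measures:
  assumes sets: "sets N = sets M" "sets P = sets M"
    and le: "\<And>S. S \<in> sets M \<Longrightarrow> emeasure M S \<le> c * (emeasure N S + emeasure P S)"
  shows "nn_integral M f \<le> c * (nn_integral N f + nn_integral P f)"
proof -
  have sp: "space N = space M" "space P = space M" using sets by (simp_all add: sets_eq_imp_space_eq[of N M] sets_eq_imp_space_eq[of P M])
  have "integral\<^sup>S M g \<le> c * (nn_integral N f + nn_integral P f)"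
    if g: "simple_function M g" "g \<le> f" for g
  proof -
    have g': "simple_function N g" "simple_function P g"
      using g(1) sets sp by (auto intro: simple_function_cong_algebra[THEN iffD1])
    have "integral\<^sup>S M g \<le> (\<Sum>v\<in>g ` space M. v * (c * (emeasure N (g -` {v} \<inter> space M) + emeasure P (g -` {v} \<inter> space M))))"
      unfolding simple_integral_def
      by (intro sum_mono mult_left_mono le simple_functionD[OF g(1)]) auto
    also have "\<dots> = c * (integral\<^sup>S N g + integral\<^sup>S P g)"
      by (simp add: simple_integral_def sp sum_distrib_left sum.distrib[symmetric] algebra_simps)
    also have "\<dots> \<le> c * (nn_integral N f + nn_integral P f)"
      using g g' by (intro mult_left_mono add_mono)
        (auto simp: nn_integral_def intro!: SUP_upper)
    finally show ?thesis .
  qed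
  then show ?thesis by (subst nn_integral_def) (auto intro!: SUP_least)
qed

section \<open>Scalar measures of a projection-valued measure\<close>

locale spectral_family =
  fixes E :: "real set \<Rightarrow> 'a::{real_inner, complete_space} \<Rightarrow> 'a"
  assumes pvm: "projection_valued_measure E"
begin

abbreviation \<mu> :: "'a \<Rightarrow> real measure" where
  "\<mu> x \<equiv> scalar_spectral_measure E x"

lemma orthogonal_projection_E: "S \<in> sets borel \<Longrightarrow> orthogonal_projection (E S)"
  using pvm by (simp add: projection_valued_measure_def)

lemma linear_E: "S \<in> sets borel \<Longrightarrow> linear (E S)"
  using orthogonal_projection_E by (simp add: orthogonal_projection_def)

lemma E_self_adjoint: "S \<in> sets borel \<Longrightarrow> inner (E S x) y = inner x (E S y)"
  using orthogonal_projection_E by (simp add: orthogonal_projection_def)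

lemma E_Int: "S \<in> sets borel \<Longrightarrow> T \<in> sets borel \<Longrightarrow> E S (E T x) = E (S \<inter> T) x"
  using pvm by (simp add: projection_valued_measure_def)

lemma E_UNIV [simp]: "E UNIV x = x"
  using pvm by (simp add: projection_valued_measure_def)

lemma E_sums:
  "range A \<subseteq> sets borel \<Longrightarrow> disjoint_family A \<Longrightarrow> (\<lambda>n. E (A n) x) sums E (\<Union>n. A n) x"
  for A :: "nat \<Rightarrow> real set"
  using pvm by (simp add: projection_valued_measure_def)

lemma E_empty [simp]: "E {} x = 0"
proof -
  have "(\<lambda>n::nat. E {} x) sums E (\<Union>n::nat. {}) x"
    by (rule E_sums) (auto simp: disjoint_family_on_def)
  then have "summable (\<lambda>n::nat. E {} x)" by (rule sums_summable)
  then show ?thesis by (simp add: summable_const_iff)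
qed

lemma inner_E_E:
  assumes "S \<in> sets borel" "T \<in> sets borel"
  shows "inner (E S x) (E T y) = inner (E (S \<inter> T) x) y"
  using assms by (metis E_Int E_self_adjoint Int_commute)

lemma inner_E_self: "S \<in> sets borel \<Longrightarrow> inner (E S x) x = (norm (E S x))\<^sup>2"
  using inner_E_E[of S S x x] by (simp add: power2_norm_eq_inner)

lemma space_\<mu> [simp]: "space (\<mu> x) = UNIV"
  by (simp add: scalar_spectral_measure_def space_measure_of_conv)

lemma sets_\<mu> [simp, measurable_cong]: "sets (\<mu> x) = sets borel"
  using sets.sigma_sets_eq[of "borel :: real measure"]
  by (simp add: scalar_spectral_measure_def)

lemma emeasure_\<mu>:
  assumes "S \<in> sets borel"
  shows "emeasure (\<mu> x) S = ennreal ((norm (E S x))\<^sup>2)"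
proof -
  have "emeasure (\<mu> x) S = ennreal (inner (E S x) x)"
  proof (rule emeasure_measure_of[of "\<mu> x" UNIV "sets borel"])
    show "\<mu> x = measure_of UNIV (sets borel) (\<lambda>S. ennreal (inner (E S x) x))"
      by (simp add: scalar_spectral_measure_def)
    show "positive (sets (\<mu> x)) (\<lambda>S. ennreal (inner (E S x) x))"
      by (simp add: positive_def)
    show "countably_additive (sets (\<mu> x)) (\<lambda>S. ennreal (inner (E S x) x))"
    proof (rule countably_additiveI)
      fix A :: "nat \<Rightarrow> real set"
      assume A: "range A \<subseteq> sets (\<mu> x)" "disjoint_family A"
      then have "(\<lambda>n. inner (E (A n) x) x) sums inner (E (\<Union>n. A n) x) x"
        by (intro bounded_linear.sums[OF bounded_linear_inner_left] E_sums) auto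
      moreover have "0 \<le> inner (E (A n) x) x" for n
        using A by (subst inner_E_self) auto
      ultimately show "(\<Sum>i. ennreal (inner (E (A i) x) x)) = ennreal (inner (E (\<Union> (range A)) x) x)"
        by (intro suminf_ennreal_eq)
    qed
    show "S \<in> sets (\<mu> x)" using assms by simp
  qed auto
  then show ?thesis using assms by (simp add: inner_E_self)
qed

lemma finite_measure_\<mu> [simp]: "finite_measure (\<mu> x)"
  by (rule finite_measureI) (simp add: emeasure_\<mu>)

lemma measure_\<mu>: "S \<in> sets borel \<Longrightarrow> measure (\<mu> x) S = (norm (E S x))\<^sup>2"
  by (simp add: measure_def emeasure_\<mu>)

lemma measure_\<mu>_UNIV [simp]: "measure (\<mu> x) UNIV = (norm x)\<^sup>2"
  by (simp add: measure_\<mu>)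

lemma polarization_\<mu>:
  assumes "S \<in> sets borel"
  shows "inner (E S x) y = (measure (\<mu> (x + y)) S - measure (\<mu> (x - y)) S) / 4"
  using inner_E_E[OF assms assms, of x y] assms
  by (simp add: measure_\<mu> linear_add[OF linear_E] linear_diff[OF linear_E]
      power2_norm_eq_inner algebra_simps inner_commute)

lemma parallelogram_\<mu>:
  assumes "S \<in> sets borel"
  shows "measure (\<mu> (x + y)) S + measure (\<mu> (x - y)) S = 2 * measure (\<mu> x) S + 2 * measure (\<mu> y) S"
  using assms
  by (simp add: measure_\<mu> linear_add[OF linear_E] linear_diff[OF linear_E]
      power2_norm_eq_inner algebra_simps inner_commute)

lemma norm_E_le: "S \<in> sets borel \<Longrightarrow> norm (E S x) \<le> norm x"
proof -
  assume S: "S \<in> sets borel"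
  have "measure (\<mu> x) S \<le> measure (\<mu> x) UNIV"
    using S by (intro finite_measure.finite_measure_mono) auto
  then show ?thesis using S by (simp add: measure_\<mu>)
qed

lemma bounded_linear_E: "S \<in> sets borel \<Longrightarrow> bounded_linear (E S)"
  using linear_E[of S] norm_E_le[of S]
  by (intro bounded_linear_intro[where K = 1]) (auto simp: linear_add linear_scale)

text \<open>For a fixed integrand \<open>f\<close>, the map \<open>x \<mapsto> \<integral> f d(\<mu> x)\<close> is a quadratic form whose domain is a
  subspace, because this holds for \<open>x \<mapsto> \<parallel>E S x\<parallel>\<^sup>2\<close>.  For \<open>f = t\<^sup>2\<close> and \<open>f = t powr (- 2 * a)\<close> this gives
  the triangle-type estimates for the scale norms.\<close>

lemma integral_parallelogram:
  fixes f :: "real \<Rightarrow> real"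
  assumes f: "f \<in> borel_measurable borel"
    and x: "integrable (\<mu> x) f" and y: "integrable (\<mu> y) f"
  shows "integrable (\<mu> (x + y)) f" "integrable (\<mu> (x - y)) f"
    "(LINT t|\<mu> (x + y). f t) + (LINT t|\<mu> (x - y). f t) = 2 * (LINT t|\<mu> x. f t) + 2 * (LINT t|\<mu> y. f t)"
proof -
  have int: "integrable (\<mu> z) f"
    if z: "\<And>S. S \<in> sets borel \<Longrightarrow> emeasure (\<mu> z) S \<le> 2 * (emeasure (\<mu> x) S + emeasure (\<mu> y) S)" for z
  proof (rule integrableI_bounded)
    show "f \<in> borel_measurable (\<mu> z)" using f by simp
    have "(\<integral>\<^sup>+ t. ennreal (norm (f t)) \<partial>\<mu> z)
        \<le> 2 * ((\<integral>\<^sup>+ t. ennreal (norm (f t)) \<partial>\<mu> x) + (\<integral>\<^sup>+ t. ennreal (norm (f t)) \<partial>\<mu> y))"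
      by (rule nn_integral_le_sum_measures) (use z in auto)
    also have "\<dots> < \<infinity>"
      using x y by (auto simp: integrable_iff_bounded ennreal_mult_less_top)
    finally show "(\<integral>\<^sup>+ t. ennreal (norm (f t)) \<partial>\<mu> z) < \<infinity>" .
  qed
  have em: "emeasure (\<mu> (x + y)) S \<le> 2 * (emeasure (\<mu> x) S + emeasure (\<mu> y) S)"
    "emeasure (\<mu> (x - y)) S \<le> 2 * (emeasure (\<mu> x) S + emeasure (\<mu> y) S)" if "S \<in> sets borel" for S
  proof -
    have "(norm (E S (x + y)))\<^sup>2 \<le> 2 * ((norm (E S x))\<^sup>2 + (norm (E S y))\<^sup>2)"
      "(norm (E S (x - y)))\<^sup>2 \<le> 2 * ((norm (E S x))\<^sup>2 + (norm (E S y))\<^sup>2)"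
      using parallelogram_\<mu>[OF that, of x y] zero_le_power2[of "norm (E S (x + y))"]
        zero_le_power2[of "norm (E S (x - y))"] that unfolding measure_\<mu>[OF that] by argo+
    moreover have "ennreal (2 * (b + c)) = 2 * (ennreal b + ennreal c)" if "0 \<le> b" "0 \<le> c" for b c
      by (subst ennreal_mult) (use that in auto)
    ultimately show "emeasure (\<mu> (x + y)) S \<le> 2 * (emeasure (\<mu> x) S + emeasure (\<mu> y) S)"
      "emeasure (\<mu> (x - y)) S \<le> 2 * (emeasure (\<mu> x) S + emeasure (\<mu> y) S)"
      unfolding emeasure_\<mu>[OF that] by (metis ennreal_leI zero_le_power2)+
  qed
  show i1: "integrable (\<mu> (x + y)) f" and i2: "integrable (\<mu> (x - y)) f"
    by (rule int, erule em)+
  show "(LINT t|\<mu> (x + y). f t) + (LINT t|\<mu> (x - y). f t) = 2 * (LINT t|\<mu> x. f t) + 2 * (LINT t|\<mu> y. f t)"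
    using integral_four_measures[of "\<mu> (x + y)" "\<mu> (x - y)" "\<mu> x" "\<mu> y" f 1 1 "- 2" "- 2"]
      i1 i2 x y f parallelogram_\<mu>[of _ x y] by simp
qed

lemma \<mu>_density:
  fixes g :: "real \<Rightarrow> real"
  assumes g: "g \<in> borel_measurable borel" "\<And>t. 0 \<le> g t" "integrable (\<mu> x) g"
    and z: "\<And>S. S \<in> sets borel \<Longrightarrow> measure (\<mu> z) S = (LINT t|\<mu> x. indicator S t * g t)"
  shows "\<mu> z = density (\<mu> x) (\<lambda>t. ennreal (g t))"
proof (rule measure_eqI)
  fix S assume "S \<in> sets (\<mu> z)"
  then have S [measurable]: "S \<in> sets borel" by simp
  have "emeasure (\<mu> z) S = ennreal (LINT t|\<mu> x. indicator S t * g t)"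
    using S by (simp add: finite_measure.emeasure_eq_measure z)
  also have "\<dots> = (\<integral>\<^sup>+t. ennreal (indicator S t * g t) \<partial>\<mu> x)"
    using g S by (intro nn_integral_eq_integral[symmetric] Bochner_Integration.integrable_bound[OF g(3)])
      (auto simp: indicator_def)
  also have "\<dots> = emeasure (density (\<mu> x) (\<lambda>t. ennreal (g t))) S"
    using g S by (subst emeasure_density) (auto intro!: nn_integral_cong simp: indicator_def)
  finally show "emeasure (\<mu> z) S = emeasure (density (\<mu> x) (\<lambda>t. ennreal (g t))) S" .
qed simp

lemma \<mu>_E:
  assumes "S \<in> sets borel"
  shows "\<mu> (E S x) = density (\<mu> x) (\<lambda>t. ennreal (indicator S t))"
proof (rule \<mu>_density)
  show "integrable (\<mu> x) (indicator S :: real \<Rightarrow> real)"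
    using assms by (intro integrable_real_indicator) (auto simp: emeasure_\<mu>)
  fix T :: "real set" assume T: "T \<in> sets borel"
  show "measure (\<mu> (E S x)) T = (LINT t|\<mu> x. indicator T t * indicator S t)"
    using assms T by (simp add: measure_\<mu> E_Int flip: indicator_inter_arith)
qed (use assms in auto)

lemma integral_\<mu>_E:
  fixes f :: "real \<Rightarrow> real"
  assumes "S \<in> sets borel" "f \<in> borel_measurable borel"
  shows "(LINT t|\<mu> (E S x). f t) = (LINT t|\<mu> x. indicator S t * f t)"
    "integrable (\<mu> (E S x)) f \<longleftrightarrow> integrable (\<mu> x) (\<lambda>t. indicator S t * f t)"
  unfolding \<mu>_E[OF assms(1)]
  by (subst integral_density, use assms in simp_all) (subst integrable_density, use assms in simp_all)

lemma AE_\<mu>_E: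
  assumes "S \<in> sets borel"
  shows "AE t in \<mu> (E S x). t \<in> S"
  unfolding \<mu>_E[OF assms] by (subst AE_density) (use assms in \<open>simp_all add: indicator_def\<close>)

text \<open>The vector \<open>E S x - x\<close> is, up to sign, the part of \<open>x\<close> with spectrum outside \<open>S\<close>.\<close>

lemma \<mu>_E_diff:
  assumes S: "S \<in> sets borel"
  shows "\<mu> (E S x - x) = density (\<mu> x) (\<lambda>t. ennreal (indicator (- S) t))"
proof (rule \<mu>_density)
  have S': "- S \<in> sets borel" using S by (rule borel_comp)
  then show "indicator (- S) \<in> borel_measurable borel" by simp
  show i: "integrable (\<mu> x) (indicator (- S) :: real \<Rightarrow> real)"
    using S' by (intro integrable_real_indicator) (auto simp: emeasure_\<mu>)
  fix T :: "real set" assume T: "T \<in> sets borel"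
  have split: "T = (T \<inter> S) \<union> (T \<inter> - S)" by blast
  have "measure (\<mu> x) T = measure (\<mu> x) (T \<inter> S) + measure (\<mu> x) (T \<inter> - S)"
    using S S' T by (subst split, intro finite_measure.finite_measure_Union) auto
  moreover have "measure (\<mu> (E S x - x)) T = measure (\<mu> x) T - measure (\<mu> x) (T \<inter> S)"
    using inner_E_E[of "T \<inter> S" T x x] inner_E_E[of "T \<inter> S" "T \<inter> S" x x] S T
    by (simp add: measure_\<mu> linear_diff[OF linear_E] E_Int power2_norm_eq_inner
        inner_diff_left inner_diff_right inner_commute Int_ac)
  ultimately show "measure (\<mu> (E S x - x)) T = (LINT t|\<mu> x. indicator T t * indicator (- S) t)"
    using S' T by (simp flip: indicator_inter_arith)
qed simp

lemma integral_\<mu>_0: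
  fixes f :: "real \<Rightarrow> real"
  assumes "f \<in> borel_measurable borel"
  shows "(LINT t|\<mu> 0. f t) = 0"
proof -
  have "\<mu> 0 = density (\<mu> 0) (\<lambda>t. ennreal (indicator {} t))"
    using \<mu>_E[of "{}" 0] by simp
  then show ?thesis using integral_\<mu>_E[of "{}" f 0] assms by simp
qed

section \<open>Existence of spectral integrals\<close>

text \<open>The spectral integral of a function with finite range, applied to a vector.\<close>

definition step_combination :: "(real \<Rightarrow> real) \<Rightarrow> 'a \<Rightarrow> 'a" where
  "step_combination s x = (\<Sum>v\<in>range s. v *\<^sub>R E (s -` {v}) x)"

lemma inner_step_combination:
  assumes "finite (range s)" "s \<in> borel_measurable borel" "S \<in> sets borel"
  shows "inner (E S (step_combination s x)) y =
    ((LINT t|\<mu> (x + y). indicator S t * s t) - (LINT t|\<mu> (x - y). indicator S t * s t)) / 4"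
proof -
  have ms: "s -` {v} \<in> sets borel" for v
    using measurable_sets[OF assms(2), of "{v}"] by simp
  have "inner (E S (step_combination s x)) y = (\<Sum>v\<in>range s. v * inner (E (S \<inter> s -` {v}) x) y)"
    using assms ms by (simp add: step_combination_def linear_sum[OF linear_E] linear_scale[OF linear_E]
        inner_sum_left E_Int)
  also have "\<dots> = (\<Sum>v\<in>range s. v * measure (\<mu> (x + y)) (S \<inter> s -` {v}) / 4
                        - v * measure (\<mu> (x - y)) (S \<inter> s -` {v}) / 4)"
    using assms(3) ms by (intro sum.cong refl, subst polarization_\<mu>) (auto simp: algebra_simps diff_divide_distrib)
  also have "\<dots> = ((\<Sum>v\<in>range s. v * measure (\<mu> (x + y)) (S \<inter> s -` {v}))
      - (\<Sum>v\<in>range s. v * measure (\<mu> (x - y)) (S \<inter> s -` {v}))) / 4"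
    by (simp add: sum_subtractf sum_divide_distrib[symmetric] diff_divide_distrib)
  finally show ?thesis
    using assms by (simp add: integral_finite_range)
qed

lemma inner_step_combinations:
  assumes s: "finite (range s)" "s \<in> borel_measurable borel"
    and r: "finite (range r)" "r \<in> borel_measurable borel" and S: "S \<in> sets borel"
  shows "inner (E S (step_combination s x)) (step_combination r x) = (LINT t|\<mu> x. indicator S t * (s t * r t))"
proof -
  have ms: "s -` {v} \<in> sets borel" "r -` {v} \<in> sets borel" for v
    using measurable_sets[OF s(2), of "{v}"] measurable_sets[OF r(2), of "{v}"] by simp_all
  have "E S (step_combination s x) = (\<Sum>v\<in>range s. v *\<^sub>R E (S \<inter> s -` {v}) x)"
    using S ms by (simp add: step_combination_def linear_sum[OF linear_E] linear_scale[OF linear_E] E_Int)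
  then have "inner (E S (step_combination s x)) (step_combination r x)
     = (\<Sum>v\<in>range s. \<Sum>w\<in>range r. v * (w * inner (E (S \<inter> s -` {v}) x) (E (r -` {w}) x)))"
    by (simp only: step_combination_def inner_sum_left)
      (simp add: inner_sum_right sum_distrib_left mult.left_commute)
  also have "\<dots> = (\<Sum>v\<in>range s. \<Sum>w\<in>range r. v * (w * measure (\<mu> x) (S \<inter> s -` {v} \<inter> r -` {w})))"
    using S ms by (simp add: inner_E_E inner_E_self measure_\<mu>)
  also have "\<dots> = (\<Sum>v\<in>range s. v * (LINT t|\<mu> x. indicator (S \<inter> s -` {v}) t * r t))"
    using S ms r by (simp add: integral_finite_range sum_distrib_left)
  also have "\<dots> = (\<Sum>v\<in>range s. (LINT t|\<mu> x. v * (indicator (S \<inter> s -` {v}) t * r t)))"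
    by simp
  also have "\<dots> = (LINT t|\<mu> x. (\<Sum>v\<in>range s. v * (indicator (S \<inter> s -` {v}) t * r t)))"
  proof (intro Bochner_Integration.integral_sum[symmetric] integrable_mult_right)
    fix v
    have "bounded (range r)" using r(1) by (rule finite_imp_bounded)
    then obtain K where K: "\<And>t. \<bar>r t\<bar> \<le> K" by (auto simp: bounded_iff)
    show "integrable (\<mu> x) (\<lambda>t. indicator (S \<inter> s -` {v}) t * r t)"
    proof (rule finite_measure.integrable_const_bound[where B = K])
      have "0 \<le> K" using K[of 0] by linarith
      with K show "AE t in \<mu> x. norm (indicator (S \<inter> s -` {v}) t * r t) \<le> K"
        by (intro AE_I2) (simp add: indicator_def)
    qed (use S ms(1)[of v] r in simp_all)
  qed
  also have "\<dots> = (LINT t|\<mu> x. indicator S t * (s t * r t))"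
  proof (rule Bochner_Integration.integral_cong[OF refl])
    fix t
    have "(\<Sum>v\<in>range s. v * (indicator (S \<inter> s -` {v}) t * r t))
        = indicator S t * ((\<Sum>v\<in>range s. v * indicator (s -` {v}) t) * r t)"
      unfolding sum_distrib_left sum_distrib_right
      by (intro sum.cong refl) (simp add: indicator_inter_arith)
    then show "(\<Sum>v\<in>range s. v * (indicator (S \<inter> s -` {v}) t * r t)) = indicator S t * (s t * r t)"
      by (simp only: finite_range_as_sum_indicators[OF s(1), symmetric])
  qed
  finally show ?thesis .
qed

text \<open>The isometry from \<open>L\<^sup>2\<close> of \<open>\<mu> x\<close> into the Hilbert space, on step functions.  Expanding the
  inner products avoids a common refinement of the two partitions.\<close>

lemma norm_diff_step_combinations:
  assumes s: "finite (range s)" "s \<in> borel_measurable borel"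
    and r: "finite (range r)" "r \<in> borel_measurable borel"
  shows "(norm (step_combination s x - step_combination r x))\<^sup>2 = (LINT t|\<mu> x. (s t - r t)\<^sup>2)"
proof -
  obtain K L where K: "\<And>t. \<bar>s t\<bar> \<le> K" and L: "\<And>t. \<bar>r t\<bar> \<le> L"
    using finite_imp_bounded[OF s(1)] finite_imp_bounded[OF r(1)] by (auto simp: bounded_iff)
  have prod: "integrable (\<mu> x) (\<lambda>t. p t * q t)"
    if "p \<in> borel_measurable borel" "q \<in> borel_measurable borel" "\<And>t. \<bar>p t\<bar> \<le> P" "\<And>t. \<bar>q t\<bar> \<le> Q" for p q :: "real \<Rightarrow> real" and P Q :: real
  proof (rule finite_measure.integrable_const_bound[where B = "P * Q"])
    have "0 \<le> P" using that(3)[of 0] by linarith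
    then show "AE t in \<mu> x. norm (p t * q t) \<le> P * Q"
      using that by (intro AE_I2) (simp add: abs_mult mult_mono)
  qed (use that in simp_all)
  have int: "integrable (\<mu> x) (\<lambda>t. s t * s t)" "integrable (\<mu> x) (\<lambda>t. s t * r t)" "integrable (\<mu> x) (\<lambda>t. r t * r t)"
    by (rule prod[OF s(2) s(2) K K], rule prod[OF s(2) r(2) K L], rule prod[OF r(2) r(2) L L])
  have "(\<lambda>t. (s t - r t)\<^sup>2) = (\<lambda>t. s t * s t - 2 * (s t * r t) + r t * r t)"
    by (simp add: power2_eq_square algebra_simps)
  then have "(LINT t|\<mu> x. (s t - r t)\<^sup>2)
      = (LINT t|\<mu> x. s t * s t) - 2 * (LINT t|\<mu> x. s t * r t) + (LINT t|\<mu> x. r t * r t)"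
    using int by simp
  also have "\<dots> = (norm (step_combination s x - step_combination r x))\<^sup>2"
    using inner_step_combinations[OF s s, of UNIV x] inner_step_combinations[OF s r, of UNIV x]
      inner_step_combinations[OF r r, of UNIV x]
    by (simp add: power2_norm_eq_inner inner_diff_left inner_diff_right inner_commute)
  finally show ?thesis by (rule sym)
qed

text \<open>By the isometry, step functions converging to \<open>f\<close> in \<open>L\<^sup>2\<close> of \<open>\<mu> x\<close> yield a Cauchy sequence of vectors;
  its limit is the spectral integral.  Both conclusions are passed to the limit on each Borel set \<open>S\<close>
  and not only on the whole line: the first one then describes the measure of \<open>z\<close>, and the
  second one allows spectral integrals to be composed.\<close>

lemma spectral_integral_exists:
  assumes f: "f \<in> borel_measurable borel" and dom: "in_spectral_domain E f x"
  obtains z where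
    "\<And>S. S \<in> sets borel \<Longrightarrow> measure (\<mu> z) S = (LINT t|\<mu> x. indicator S t * (f t)\<^sup>2)"
    "\<And>S y. S \<in> sets borel \<Longrightarrow> in_spectral_domain E f y \<Longrightarrow>
       inner (E S z) y = ((LINT t|\<mu> (x + y). indicator S t * f t) - (LINT t|\<mu> (x - y). indicator S t * f t)) / 4"
proof -
  obtain s where s: "\<And>n. finite (range (s n))" "\<And>n. s n \<in> borel_measurable borel"
    "\<And>t. (\<lambda>n. s n t) \<longlonglongrightarrow> f t" "\<And>n t. \<bar>s n t\<bar> \<le> 2 * \<bar>f t\<bar>"
    using simple_approximation[OF f] by blast
  define u where "u n = step_combination (s n) x" for n
  have f2: "integrable (\<mu> x) (\<lambda>t. (f t)\<^sup>2)" using dom by (simp add: in_spectral_domain_def)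
  note [measurable] = f s(2)
  have bnd: "(s n t - f t)\<^sup>2 \<le> 9 * (f t)\<^sup>2" "(s n t)\<^sup>2 \<le> 4 * (f t)\<^sup>2" for n t
  proof -
    have "\<bar>s n t - f t\<bar>\<^sup>2 \<le> (3 * \<bar>f t\<bar>)\<^sup>2" using s(4)[of n t] by (intro power_mono) linarith+
    then show "(s n t - f t)\<^sup>2 \<le> 9 * (f t)\<^sup>2" by (simp add: power_mult_distrib)
    have "\<bar>s n t\<bar>\<^sup>2 \<le> (2 * \<bar>f t\<bar>)\<^sup>2" using s(4)[of n t] by (intro power_mono) linarith+
    then show "(s n t)\<^sup>2 \<le> 4 * (f t)\<^sup>2" by (simp add: power_mult_distrib)
  qed
  define e where "e n = (LINT t|\<mu> x. (s n t - f t)\<^sup>2)" for n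
  have ei: "integrable (\<mu> x) (\<lambda>t. (s n t - f t)\<^sup>2)" for n
    by (rule Bochner_Integration.integrable_bound[where f = "\<lambda>t. 9 * (f t)\<^sup>2"]) (use f2 bnd in auto)
  have e0: "e \<longlonglongrightarrow> 0"
  proof -
    have "e \<longlonglongrightarrow> (LINT t|\<mu> x. 0)" unfolding e_def
    proof (rule integral_dominated_convergence[where w = "\<lambda>t. 9 * (f t)\<^sup>2"])
      show "AE t in \<mu> x. (\<lambda>n. (s n t - f t)\<^sup>2) \<longlonglongrightarrow> 0"
      proof (intro AE_I2)
        fix t
        have "(\<lambda>n. (s n t - f t)\<^sup>2) \<longlonglongrightarrow> (f t - f t)\<^sup>2" by (intro tendsto_intros s)
        then show "(\<lambda>n. (s n t - f t)\<^sup>2) \<longlonglongrightarrow> 0" by simp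
      qed
    qed (use f2 bnd in auto)
    then show ?thesis by simp
  qed
  have un: "(norm (u n - u m))\<^sup>2 \<le> 2 * e n + 2 * e m" for n m
  proof -
    have "(norm (u n - u m))\<^sup>2 = (LINT t|\<mu> x. (s n t - s m t)\<^sup>2)"
      unfolding u_def by (rule norm_diff_step_combinations[OF s(1,2) s(1,2)])
    also have "\<dots> \<le> (LINT t|\<mu> x. 2 * (s n t - f t)\<^sup>2 + 2 * (s m t - f t)\<^sup>2)"
    proof (rule integral_mono)
      have *: "(p - q)\<^sup>2 \<le> 2 * (p - c)\<^sup>2 + 2 * (q - c)\<^sup>2" for p q c :: real
        using zero_le_power2[of "p + q - 2 * c"] by (simp add: power2_eq_square algebra_simps)
      show "(s n t - s m t)\<^sup>2 \<le> 2 * (s n t - f t)\<^sup>2 + 2 * (s m t - f t)\<^sup>2" for t by (rule *)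
      show i: "integrable (\<mu> x) (\<lambda>t. 2 * (s n t - f t)\<^sup>2 + 2 * (s m t - f t)\<^sup>2)"
        using ei by auto
      show "integrable (\<mu> x) (\<lambda>t. (s n t - s m t)\<^sup>2)"
        by (rule Bochner_Integration.integrable_bound[OF i]) (use * in auto)
    qed
    also have "\<dots> = 2 * e n + 2 * e m" using ei by (simp add: e_def)
    finally show ?thesis .
  qed
  have "Cauchy u"
  proof (rule CauchyI)
    fix d :: real assume "0 < d"
    then have "0 < d\<^sup>2 / 4" by simp
    with e0 have "eventually (\<lambda>n. e n < d\<^sup>2 / 4) sequentially" by (rule order_tendstoD)
    then obtain N where N: "\<And>n. n \<ge> N \<Longrightarrow> e n < d\<^sup>2 / 4" by (auto simp: eventually_sequentially)
    have "norm (u m - u n) < d" if "m \<ge> N" "n \<ge> N" for m n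
      using un[of m n] N[OF that(1)] N[OF that(2)] \<open>0 < d\<close>
      by (intro power2_less_imp_less[of _ d]) auto
    then show "\<exists>M. \<forall>m\<ge>M. \<forall>n\<ge>M. norm (u m - u n) < d" by blast
  qed
  then obtain z where z: "u \<longlonglongrightarrow> z" using Cauchy_convergent by (auto simp: convergent_def)
  have Ez: "(\<lambda>n. E S (u n)) \<longlonglongrightarrow> E S z" if "S \<in> sets borel" for S
    using bounded_linear.tendsto[OF bounded_linear_E[OF that] z] .
  show thesis
  proof (rule that)
    fix S :: "real set" assume S [measurable]: "S \<in> sets borel"
    have "(\<lambda>n. inner (E S (u n)) (u n)) \<longlonglongrightarrow> inner (E S z) z"
      by (intro tendsto_inner Ez z S)
    moreover have "inner (E S (u n)) (u n) = (LINT t|\<mu> x. indicator S t * (s n t * s n t))" for n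
      unfolding u_def by (rule inner_step_combinations[OF s(1,2) s(1,2) S])
    moreover have "(\<lambda>n. LINT t|\<mu> x. indicator S t * (s n t * s n t)) \<longlonglongrightarrow> (LINT t|\<mu> x. indicator S t * (f t * f t))"
    proof (rule integral_dominated_convergence[where w = "\<lambda>t. 4 * (f t)\<^sup>2"])
      show "AE t in \<mu> x. (\<lambda>n. indicator S t * (s n t * s n t)) \<longlonglongrightarrow> indicator S t * (f t * f t)"
        by (intro AE_I2 tendsto_mult tendsto_const s)
      show "AE t in \<mu> x. norm (indicator S t * (s n t * s n t)) \<le> 4 * (f t)\<^sup>2" for n
        using bnd(2)[of n] by (auto simp: indicator_def power2_eq_square intro!: AE_I2)
    qed (use f2 in auto)
    ultimately have "inner (E S z) z = (LINT t|\<mu> x. indicator S t * (f t * f t))"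
      using LIMSEQ_unique by fastforce
    then show "measure (\<mu> z) S = (LINT t|\<mu> x. indicator S t * (f t)\<^sup>2)"
      using S by (simp add: measure_\<mu> inner_E_self power2_eq_square)
  next
    fix S :: "real set" and y assume S [measurable]: "S \<in> sets borel" and y: "in_spectral_domain E f y"
    have L: "(\<lambda>n. LINT t|\<mu> v. indicator S t * s n t) \<longlonglongrightarrow> (LINT t|\<mu> v. indicator S t * f t)"
      if "integrable (\<mu> v) (\<lambda>t. (f t)\<^sup>2)" for v
    proof (rule integral_dominated_convergence[where w = "\<lambda>t. 2 * \<bar>f t\<bar>"])
      show "integrable (\<mu> v) (\<lambda>t. 2 * \<bar>f t\<bar>)"
        using finite_measure.square_integrable_imp_integrable[OF finite_measure_\<mu> _ that] by auto
      show "AE t in \<mu> v. (\<lambda>n. indicator S t * s n t) \<longlonglongrightarrow> indicator S t * f t"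
        by (intro AE_I2 tendsto_mult tendsto_const s)
      show "AE t in \<mu> v. norm (indicator S t * s n t) \<le> 2 * \<bar>f t\<bar>" for n
        using s(4)[of n] by (auto simp: indicator_def intro!: AE_I2)
    qed auto
    have y2: "integrable (\<mu> y) (\<lambda>t. (f t)\<^sup>2)" using y by (simp add: in_spectral_domain_def)
    have "(\<lambda>n. ((LINT t|\<mu> (x + y). indicator S t * s n t) - (LINT t|\<mu> (x - y). indicator S t * s n t)) / 4)
      \<longlonglongrightarrow> ((LINT t|\<mu> (x + y). indicator S t * f t) - (LINT t|\<mu> (x - y). indicator S t * f t)) / 4"
      by (intro tendsto_divide tendsto_diff tendsto_const L integral_parallelogram f2 y2) auto
    moreover have "(\<lambda>n. inner (E S (u n)) y) \<longlonglongrightarrow> inner (E S z) y"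
      by (intro tendsto_inner Ez tendsto_const S)
    ultimately show "inner (E S z) y = ((LINT t|\<mu> (x + y). indicator S t * f t) - (LINT t|\<mu> (x - y). indicator S t * f t)) / 4"
      unfolding u_def inner_step_combination[OF s(1,2) S] by (rule LIMSEQ_unique[symmetric])
  qed
qed

text \<open>The same result, with the measure of \<open>z\<close> written as a density, which is the form in which
  integrals against \<open>\<mu> z\<close> are computed.\<close>

lemma has_spectral_integral_exists:
  assumes f: "f \<in> borel_measurable borel" and dom: "in_spectral_domain E f x"
  obtains z where "has_spectral_integral E f x z"
    "\<mu> z = density (\<mu> x) (\<lambda>t. ennreal ((f t)\<^sup>2))"
    "\<And>S y. S \<in> sets borel \<Longrightarrow> in_spectral_domain E f y \<Longrightarrow>
       inner (E S z) y = ((LINT t|\<mu> (x + y). indicator S t * f t) - (LINT t|\<mu> (x - y). indicator S t * f t)) / 4"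
proof -
  obtain z where z: "\<And>S. S \<in> sets borel \<Longrightarrow> measure (\<mu> z) S = (LINT t|\<mu> x. indicator S t * (f t)\<^sup>2)"
    "\<And>S y. S \<in> sets borel \<Longrightarrow> in_spectral_domain E f y \<Longrightarrow>
       inner (E S z) y = ((LINT t|\<mu> (x + y). indicator S t * f t) - (LINT t|\<mu> (x - y). indicator S t * f t)) / 4"
    using spectral_integral_exists[OF f dom] by blast
  show thesis
  proof (rule that)
    show "has_spectral_integral E f x z"
      using dom z(2)[of UNIV] by (simp add: has_spectral_integral_def)
    show "\<mu> z = density (\<mu> x) (\<lambda>t. ennreal ((f t)\<^sup>2))"
      using f dom z(1) by (intro \<mu>_density) (auto simp: in_spectral_domain_def)
  qed (fact z(2))
qed

end

section \<open>Spectrum and surjectivity of a coercive positive operator\<close>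

text \<open>The measure \<open>E\<close> is a parameter of the locale so that two spectral measures of the same
  operator can be compared by interpreting the locale twice.\<close>

locale positive_spectral_family = spectral_family E
  for E :: "real set \<Rightarrow> 'a::{real_inner, complete_space} \<Rightarrow> 'a" +
  fixes D :: "'a set" and B :: "'a \<Rightarrow> 'a" and c :: real
  assumes spectral_measure: "spectral_measure_of D B E"
    and positive: "strictly_positive_on D B"
    and c_pos: "0 < c" and coercive: "\<And>x. x \<in> D \<Longrightarrow> c * norm x \<le> norm (B x)"
begin

lemma has_spectral_integral_id: "has_spectral_integral E (\<lambda>t. t) x z \<longleftrightarrow> x \<in> D \<and> z = B x"
  using spectral_measure unfolding spectral_measure_of_def by blast

lemma D_iff: "x \<in> D \<longleftrightarrow> integrable (\<mu> x) (\<lambda>t. t\<^sup>2)"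
proof
  assume "x \<in> D"
  then have "has_spectral_integral E (\<lambda>t. t) x (B x)" by (simp add: has_spectral_integral_id)
  then show "integrable (\<mu> x) (\<lambda>t. t\<^sup>2)"
    by (simp add: has_spectral_integral_def in_spectral_domain_def)
next
  assume "integrable (\<mu> x) (\<lambda>t. t\<^sup>2)"
  then have "in_spectral_domain E (\<lambda>t. t) x" unfolding in_spectral_domain_def .
  then obtain z where "has_spectral_integral E (\<lambda>t. t) x z"
    by (rule has_spectral_integral_exists[of "\<lambda>t. t" x, rotated]) auto
  then show "x \<in> D" by (simp add: has_spectral_integral_id)
qed

lemma \<mu>_B:
  assumes "x \<in> D"
  shows "\<mu> (B x) = density (\<mu> x) (\<lambda>t. ennreal (t\<^sup>2))"
proof -
  have "in_spectral_domain E (\<lambda>t. t) x"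
    using assms unfolding in_spectral_domain_def D_iff .
  then obtain z where "has_spectral_integral E (\<lambda>t. t) x z" "\<mu> z = density (\<mu> x) (\<lambda>t. ennreal (t\<^sup>2))"
    by (rule has_spectral_integral_exists[of "\<lambda>t. t" x, rotated]) auto
  then show ?thesis by (simp add: has_spectral_integral_id)
qed

lemma norm_B: "x \<in> D \<Longrightarrow> (norm (B x))\<^sup>2 = (LINT t|\<mu> x. t\<^sup>2)"
proof -
  assume x: "x \<in> D"
  have "(norm (B x))\<^sup>2 = (LINT t|\<mu> (B x). 1)" by simp
  also have "\<dots> = (LINT t|\<mu> x. t\<^sup>2)"
    using x by (simp only: \<mu>_B, subst integral_density) auto
  finally show ?thesis .
qed

lemma E_bounded_in_D:
  assumes "S \<in> sets borel" "bounded S"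
  shows "E S x \<in> D"
proof -
  obtain K where K: "\<And>t. t \<in> S \<Longrightarrow> \<bar>t\<bar> \<le> K" using assms(2) by (auto simp: bounded_iff)
  have "\<bar>t\<bar>\<^sup>2 \<le> K\<^sup>2" if "t \<in> S" for t using K[OF that] by (intro power_mono) auto
  then have "integrable (\<mu> x) (\<lambda>t. indicator S t * t\<^sup>2)"
    using assms(1) by (intro finite_measure.integrable_const_bound[where B = "K\<^sup>2"]) (auto simp: indicator_def)
  then show ?thesis using assms(1) by (simp add: D_iff integral_\<mu>_E)
qed

text \<open>The spectrum lies in \<open>{c..}\<close>.  A vector with spectrum in \<open>{0..<c}\<close> would violate coercivity, and one
  with spectrum in a bounded part of the negative half-line would violate positivity; boundedness puts
  the vector into the domain of \<open>B\<close>.\<close>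

lemma AE_ge_c: "AE t in \<mu> x. c \<le> t"
proof -
  have 1: "AE t in \<mu> x. t \<notin> {0..<c}"
  proof -
    let ?S = "{0..<c}"
    let ?w = "E ?S x"
    have w: "?w \<in> D" by (rule E_bounded_in_D) auto
    have i: "integrable (\<mu> x) (\<lambda>t. indicator ?S t * t\<^sup>2)" "integrable (\<mu> x) (\<lambda>t. indicator ?S t * c\<^sup>2)"
      using w by (simp_all add: D_iff integral_\<mu>_E integrable_real_indicator emeasure_\<mu>)
    have "c\<^sup>2 * (norm ?w)\<^sup>2 \<le> (norm (B ?w))\<^sup>2"
      using power_mono[OF coercive[OF w], of 2] c_pos by (simp add: power_mult_distrib)
    then have "(LINT t|\<mu> x. indicator ?S t * c\<^sup>2) \<le> (LINT t|\<mu> x. indicator ?S t * t\<^sup>2)"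
      using w by (simp add: norm_B integral_\<mu>_E measure_\<mu> mult.commute)
    then have "(LINT t|\<mu> x. indicator ?S t * c\<^sup>2 - indicator ?S t * t\<^sup>2) \<le> 0" using i by simp
    moreover have nn: "0 \<le> indicator ?S t * c\<^sup>2 - indicator ?S t * t\<^sup>2" for t
      by (auto simp: indicator_def power_mono)
    ultimately have "(LINT t|\<mu> x. indicator ?S t * c\<^sup>2 - indicator ?S t * t\<^sup>2) = 0"
      by (intro antisym Bochner_Integration.integral_nonneg)
    then have "AE t in \<mu> x. indicator ?S t * c\<^sup>2 - indicator ?S t * t\<^sup>2 = 0"
      using integral_nonneg_eq_0_iff_AE[of "\<mu> x" "\<lambda>t. indicator ?S t * c\<^sup>2 - indicator ?S t * t\<^sup>2"] i nn
      by auto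
    then show ?thesis
    proof (rule AE_mp, intro AE_I2 impI notI)
      fix t assume "indicator ?S t * c\<^sup>2 - indicator ?S t * t\<^sup>2 = 0" "t \<in> ?S"
      then show False using power2_eq_iff_nonneg[of c t] by auto
    qed
  qed
  have 2: "AE t in \<mu> x. t \<notin> {- real n..<0}" for n
  proof -
    let ?S = "{- real n..<0}"
    let ?w = "E ?S x"
    have w: "?w \<in> D" by (rule E_bounded_in_D) auto
    have "inner (B ?w) ?w = ((LINT t|\<mu> (?w + ?w). t) - (LINT t|\<mu> (?w - ?w). t)) / 4"
      using has_spectral_integral_id[of ?w "B ?w"] w unfolding has_spectral_integral_def by blast
    also have "\<dots> = (LINT t|\<mu> (E ?S (x + x)). t) / 4"
      by (simp add: linear_add[OF linear_E] integral_\<mu>_0)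
    also have "\<dots> \<le> 0"
    proof -
      have "AE t in \<mu> (E ?S (x + x)). 0 \<le> - t"
        by (rule eventually_mono[OF AE_\<mu>_E]) simp_all
      then have "0 \<le> (LINT t|\<mu> (E ?S (x + x)). - t)" by (rule integral_nonneg_AE)
      then show ?thesis by simp
    qed
    finally have "?w = 0"
      using positive w by (force simp: strictly_positive_on_def)
    then have "?S \<in> null_sets (\<mu> x)" by (simp add: null_sets_def emeasure_\<mu>)
    then show ?thesis by (rule AE_not_in)
  qed
  have "AE t in \<mu> x. \<forall>n. t \<notin> {- real n..<0}"
    unfolding AE_all_countable using 2 by blast
  with 1 show ?thesis
  proof eventually_elim
    case (elim t)
    obtain n where "- t \<le> real n" using real_arch_simple by blast
    with elim show ?case by (metis atLeastLessThan_iff minus_le_iff not_le)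
  qed
qed

lemma integrable_bounded_on_spectrum:
  fixes f :: "real \<Rightarrow> real"
  assumes "f \<in> borel_measurable borel" "\<And>t. c \<le> t \<Longrightarrow> \<bar>f t\<bar> \<le> K"
  shows "integrable (\<mu> x) f"
  using assms AE_ge_c[of x]
  by (intro finite_measure.integrable_const_bound[where B = K]) (auto elim!: eventually_mono)

lemma in_spectral_domain_bounded:
  fixes f :: "real \<Rightarrow> real"
  assumes "f \<in> borel_measurable borel" "\<And>t. c \<le> t \<Longrightarrow> \<bar>f t\<bar> \<le> K"
  shows "in_spectral_domain E f x"
proof -
  have "\<bar>(f t)\<^sup>2\<bar> \<le> K\<^sup>2" if "c \<le> t" for t
    using power_mono[OF assms(2)[OF that], of 2] by simp
  then show ?thesis
    unfolding in_spectral_domain_def using assms(1) by (intro integrable_bounded_on_spectrum) auto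
qed

text \<open>The preimage of \<open>u\<close> is \<open>w = (\<integral> 1/t dE) u\<close>.  To see that \<open>B w = u\<close>, the signed measure
  \<open>S \<mapsto> \<langle>E S w, y\<rangle>\<close> is identified with \<open>1/t\<close> times \<open>S \<mapsto> \<langle>E S u, y\<rangle>\<close>, so that integrating \<open>t\<close> against it
  gives back \<open>\<langle>u, y\<rangle>\<close>.\<close>

lemma surjective_B: "\<exists>w\<in>D. B w = u"
proof -
  define f :: "real \<Rightarrow> real" where "f t = (if 0 < t then 1 / t else 0)" for t
  \<comment> \<open>The cut at 0 makes \<open>f\<close> a nonnegative function everywhere, as a density has to be.\<close>
  have f [measurable]: "f \<in> borel_measurable borel" unfolding f_def by simp
  have f0: "0 \<le> f t" for t by (simp add: f_def)
  have fb: "\<bar>f t\<bar> \<le> 1 / c" if "c \<le> t" for t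
    using that c_pos by (auto simp: f_def frac_le)
  have tf: "\<bar>t * f t\<bar> \<le> 1" for t by (simp add: f_def)
  have AE1: "AE t in \<mu> v. t * f t = 1" for v
    using AE_ge_c[of v] c_pos by (auto simp: f_def elim!: eventually_mono)
  have dom: "in_spectral_domain E f v" for v
    using f fb by (rule in_spectral_domain_bounded)
  obtain w where "has_spectral_integral E f u w"
    and w: "\<mu> w = density (\<mu> u) (\<lambda>t. ennreal ((f t)\<^sup>2))"
    and inner_w: "\<And>S y. S \<in> sets borel \<Longrightarrow> in_spectral_domain E f y \<Longrightarrow>
       inner (E S w) y = ((LINT t|\<mu> (u + y). indicator S t * f t) - (LINT t|\<mu> (u - y). indicator S t * f t)) / 4"
    by (rule has_spectral_integral_exists[OF f dom[of u]]) (rule that)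
  have w2: "integrable (\<mu> w) (\<lambda>t. t\<^sup>2)"
  proof -
    have "\<bar>(f t)\<^sup>2 * t\<^sup>2\<bar> \<le> 1" for t using power_mono[OF tf[of t], of 2] by (simp add: power_mult_distrib[symmetric] mult.commute)
    then show ?thesis
      unfolding w by (subst integrable_density) (auto intro!: integrable_bounded_on_spectrum[where K = 1])
  qed
  have fi: "integrable (\<mu> v) f" for v using f fb by (rule integrable_bounded_on_spectrum)
  define N where "N v = density (\<mu> v) (\<lambda>t. ennreal (f t))" for v
  have N_sets: "sets (N v) = sets borel" for v by (simp add: N_def)
  have N_fin: "finite_measure (N v)" for v
  proof (rule finite_measureI)
    have "emeasure (N v) (space (N v)) = ennreal (LINT t|\<mu> v. f t)"
      using fi f0 by (simp add: N_def emeasure_density nn_integral_eq_integral)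
    then show "emeasure (N v) (space (N v)) \<noteq> \<infinity>" by simp
  qed
  have N_meas: "measure (N v) S = (LINT t|\<mu> v. indicator S t * f t)" if [measurable]: "S \<in> sets borel" for v S
  proof -
    have "emeasure (N v) S = (\<integral>\<^sup>+t. ennreal (indicator S t * f t) \<partial>\<mu> v)"
      unfolding N_def by (subst emeasure_density) (auto intro!: nn_integral_cong simp: indicator_def)
    also have "\<dots> = ennreal (LINT t|\<mu> v. indicator S t * f t)"
      using f0 by (intro nn_integral_eq_integral Bochner_Integration.integrable_bound[OF fi])
       (auto simp: indicator_def)
    finally show ?thesis using f0 by (simp add: measure_def Bochner_Integration.integral_nonneg)
  qed
  have N_int: "integrable (N v) (\<lambda>t. t)" "(LINT t|N v. t) = (norm v)\<^sup>2" for v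
  proof -
    show "integrable (N v) (\<lambda>t. t)"
      unfolding N_def using f0 tf by (subst integrable_density)
        (auto intro!: integrable_bounded_on_spectrum[where K = 1] simp: mult.commute)
    have "(LINT t|N v. t) = (LINT t|\<mu> v. t * f t)"
      unfolding N_def using f0 by (subst integral_density) (auto simp: mult.commute)
    also have "\<dots> = (LINT t|\<mu> v. 1)"
      using AE1 by (intro integral_cong_AE) auto
    finally show "(LINT t|N v. t) = (norm v)\<^sup>2" by simp
  qed
  have "has_spectral_integral E (\<lambda>t. t) w u"
    unfolding has_spectral_integral_def
  proof (intro conjI allI impI)
    show "in_spectral_domain E (\<lambda>t. t) w" using w2 by (simp add: in_spectral_domain_def)
    fix y assume "in_spectral_domain E (\<lambda>t. t) y"
    then have y2: "integrable (\<mu> y) (\<lambda>t. t\<^sup>2)" by (simp add: in_spectral_domain_def)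
    have i: "integrable (\<mu> (w + y)) (\<lambda>t. t)" "integrable (\<mu> (w - y)) (\<lambda>t. t)"
      by (rule finite_measure.square_integrable_imp_integrable[OF finite_measure_\<mu> _
            integral_parallelogram(1)[OF _ w2 y2]]; simp)
        (rule finite_measure.square_integrable_imp_integrable[OF finite_measure_\<mu> _
            integral_parallelogram(2)[OF _ w2 y2]]; simp)
    have "measure (\<mu> (w + y)) S - measure (\<mu> (w - y)) S - measure (N (u + y)) S + measure (N (u - y)) S = 0"
      if S: "S \<in> sets borel" for S
      using inner_w[OF S dom, of y] polarization_\<mu>[OF S, of w y] N_meas[OF S] by simp
    then have "1 * (LINT t|\<mu> (w + y). t) + - 1 * (LINT t|\<mu> (w - y). t)
        + - 1 * (LINT t|N (u + y). t) + 1 * (LINT t|N (u - y). t) = 0"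
      by (intro integral_four_measures finite_measure_\<mu> N_fin sets_\<mu> N_sets i N_int(1)) simp_all
    then have "(LINT t|\<mu> (w + y). t) - (LINT t|\<mu> (w - y). t) = (norm (u + y))\<^sup>2 - (norm (u - y))\<^sup>2"
      unfolding N_int(2) by linarith
    then show "inner u y = ((LINT t|\<mu> (w + y). t) - (LINT t|\<mu> (w - y). t)) / 4"
      by (simp add: power2_norm_eq_inner algebra_simps inner_commute)
  qed
  then show ?thesis by (auto simp: has_spectral_integral_id)
qed

section \<open>Negative powers are independent of the spectral measure\<close>

text \<open>A vector enters the Hilbert scale through some spectral measure, possibly different from \<open>E\<close>;
  membership in \<open>D\<close> is the same for all of them.\<close>

lemma hilbert_scale_1: "hilbert_scale D B 1 = D"
proof
  have p1: "t powr 1 = \<bar>t\<bar>" for t :: real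
    by (cases "0 \<le> t") (simp_all add: uminus_powr_eq[symmetric, of t])
  show "hilbert_scale D B 1 \<subseteq> D"
  proof
    fix x assume "x \<in> hilbert_scale D B 1"
    then obtain E' z where E': "spectral_measure_of D B E'" and z: "has_spectral_integral E' (\<lambda>t. t powr 1) x z"
      by (auto simp: hilbert_scale_def operator_power_def)
    interpret other: positive_spectral_family E' D B c
      using E' positive c_pos coercive by unfold_locales (auto simp: spectral_measure_of_def)
    have "integrable (scalar_spectral_measure E' x) (\<lambda>t. (t powr 1)\<^sup>2)"
      using z by (simp only: has_spectral_integral_def in_spectral_domain_def)
    then show "x \<in> D" by (simp only: p1 power2_abs other.D_iff)
  qed
  show "D \<subseteq> hilbert_scale D B 1"
  proof
    fix x assume "x \<in> D"
    then have "in_spectral_domain E (\<lambda>t. t powr 1) x"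
      by (simp only: p1 power2_abs D_iff in_spectral_domain_def)
    then obtain z where "has_spectral_integral E (\<lambda>t. t powr 1) x z"
      by (rule has_spectral_integral_exists[rotated]) auto
    then show "x \<in> hilbert_scale D B 1"
      unfolding hilbert_scale_def operator_power_def using spectral_measure by blast
  qed
qed

text \<open>The measure of \<open>B w\<close> has density \<open>t\<^sup>2\<close> with respect to that of \<open>w\<close>, which lowers the order of an
  inverse moment by one.\<close>

lemma inverse_moment_B:
  assumes w: "w \<in> D"
  shows "(LINT t|\<mu> (B w). (1 / t\<^sup>2) ^ Suc k) = (LINT t|\<mu> w. (1 / t\<^sup>2) ^ k)"
proof -
  have "(LINT t|\<mu> (B w). (1 / t\<^sup>2) ^ Suc k) = (LINT t|\<mu> w. t\<^sup>2 * (1 / t\<^sup>2) ^ Suc k)"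
    unfolding \<mu>_B[OF w] by (subst integral_density) auto
  also have "\<dots> = (LINT t|\<mu> w. (1 / t\<^sup>2) ^ k)"
  proof (rule integral_cong_AE)
    show "AE t in \<mu> w. t\<^sup>2 * (1 / t\<^sup>2) ^ Suc k = (1 / t\<^sup>2) ^ k"
      using AE_ge_c[of w]
    proof eventually_elim
      case (elim t)
      with c_pos have "t\<^sup>2 \<noteq> 0" by simp
      then show ?case by simp
    qed
  qed auto
  finally show ?thesis .
qed

text \<open>Iterating preimages under \<open>B\<close>, the moment of order \<open>k\<close> is the squared norm of the \<open>k\<close>-th iterated
  preimage of \<open>u\<close>, a quantity that does not refer to a spectral measure.\<close>

lemma inverse_moment_unique:
  assumes "positive_spectral_family E' D B c"
  shows "(LINT t|\<mu> u. (1 / t\<^sup>2) ^ k) = (LINT t|scalar_spectral_measure E' u. (1 / t\<^sup>2) ^ k)"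
proof (induction k arbitrary: u)
  case 0
  interpret other: positive_spectral_family E' D B c by fact
  show ?case by simp
next
  case (Suc k)
  interpret other: positive_spectral_family E' D B c by fact
  obtain w where w: "w \<in> D" "B w = u" using surjective_B by blast
  show ?case
    using inverse_moment_B[OF w(1), of k] other.inverse_moment_B[OF w(1), of k] Suc.IH[of w]
    unfolding w(2) by simp
qed

lemma inverse_square_bounds:
  assumes "c \<le> t"
  shows "1 / t\<^sup>2 \<in> {0..1 / c\<^sup>2}"
  using assms c_pos by (simp add: frac_le power_mono)

lemma integral_polynomial_approximation:
  fixes h :: "real \<Rightarrow> real"
  assumes h: "h \<in> borel_measurable borel"
    and approx: "\<And>s. s \<in> {0..1 / c\<^sup>2} \<Longrightarrow> \<bar>h s - (\<Sum>i\<le>n. b i * s ^ i)\<bar> \<le> e"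
  shows "\<bar>(LINT t|\<mu> u. h (1 / t\<^sup>2)) - (\<Sum>i\<le>n. b i * (LINT t|\<mu> u. (1 / t\<^sup>2) ^ i))\<bar> \<le> e * (norm u)\<^sup>2"
proof -
  let ?q = "\<lambda>t::real. \<Sum>i\<le>n. b i * (1 / t\<^sup>2) ^ i"
  note [measurable] = h
  have mom: "integrable (\<mu> u) (\<lambda>t. (1 / t\<^sup>2) ^ i)" for i
  proof (rule integrable_bounded_on_spectrum[where K = "(1 / c\<^sup>2) ^ i"])
    fix t assume "c \<le> t"
    then show "\<bar>(1 / t\<^sup>2) ^ i\<bar> \<le> (1 / c\<^sup>2) ^ i"
      unfolding power_abs using inverse_square_bounds[of t] by (intro power_mono) auto
  qed auto
  then have q: "integrable (\<mu> u) ?q" by auto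
  have d: "integrable (\<mu> u) (\<lambda>t. h (1 / t\<^sup>2) - ?q t)"
    by (rule integrable_bounded_on_spectrum[where K = e]) (auto intro!: approx inverse_square_bounds)
  have hi: "integrable (\<mu> u) (\<lambda>t. h (1 / t\<^sup>2))"
    using Bochner_Integration.integrable_add[OF d q] by simp
  have "(LINT t|\<mu> u. h (1 / t\<^sup>2)) - (\<Sum>i\<le>n. b i * (LINT t|\<mu> u. (1 / t\<^sup>2) ^ i))
      = (LINT t|\<mu> u. h (1 / t\<^sup>2) - ?q t)"
    using hi q mom by (simp add: Bochner_Integration.integral_sum)
  also have "\<bar>\<dots>\<bar> \<le> (LINT t|\<mu> u. e)"
  proof -
    have "\<bar>LINT t|\<mu> u. h (1 / t\<^sup>2) - ?q t\<bar> \<le> (LINT t|\<mu> u. \<bar>h (1 / t\<^sup>2) - ?q t\<bar>)"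
      using integral_norm_bound[of "\<mu> u" "\<lambda>t. h (1 / t\<^sup>2) - ?q t"] by simp
    also have "\<dots> \<le> (LINT t|\<mu> u. e)"
    proof (rule integral_mono_AE)
      show "AE t in \<mu> u. \<bar>h (1 / t\<^sup>2) - ?q t\<bar> \<le> e"
        using AE_ge_c[of u] by eventually_elim (intro approx inverse_square_bounds)
    qed (use d in \<open>auto simp: finite_measure.integrable_const\<close>)
    finally show ?thesis .
  qed
  also have "(LINT t|\<mu> u. e) = e * (norm u)\<^sup>2" by simp
  finally show ?thesis .
qed

text \<open>On the spectrum, \<open>1 / t\<^sup>2\<close> takes values in a compact interval, on which continuous
  functions are uniform limits of polynomials.\<close>

lemma integral_continuous_unique:
  fixes h :: "real \<Rightarrow> real"
  assumes other: "positive_spectral_family E' D B c"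
    and h: "h \<in> borel_measurable borel" "continuous_on {0..1 / c\<^sup>2} h"
  shows "(LINT t|\<mu> u. h (1 / t\<^sup>2)) = (LINT t|scalar_spectral_measure E' u. h (1 / t\<^sup>2))" (is "?L = ?R")
proof -
  interpret other: positive_spectral_family E' D B c by fact
  have "\<bar>?L - ?R\<bar> \<le> 0 + d" if "0 < d" for d
  proof -
    define e where "e = d / (2 * ((norm u)\<^sup>2 + 1))"
    have N: "0 < (norm u)\<^sup>2 + 1" by (simp add: add_nonneg_pos)
    with that have "0 < e" by (simp add: e_def)
    then obtain g where g: "real_polynomial_function g" "\<And>s. s \<in> {0..1 / c\<^sup>2} \<Longrightarrow> \<bar>h s - g s\<bar> < e"
      using Stone_Weierstrass_real_polynomial_function[OF compact_Icc h(2)] by blast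
    then obtain b n where b: "g = (\<lambda>s. \<Sum>i\<le>n. b i * s ^ i)"
      unfolding real_polynomial_function_iff_sum by blast
    have approx: "\<bar>h s - (\<Sum>i\<le>n. b i * s ^ i)\<bar> \<le> e" if "s \<in> {0..1 / c\<^sup>2}" for s
      using g(2)[OF that] by (simp add: b)
    have "\<bar>?L - ?R\<bar> \<le> 2 * (e * (norm u)\<^sup>2)"
      using integral_polynomial_approximation[OF h(1) approx, of u]
        other.integral_polynomial_approximation[OF h(1) approx, of u]
      unfolding inverse_moment_unique[OF other] by linarith
    also have "\<dots> \<le> 2 * (e * ((norm u)\<^sup>2 + 1))" using \<open>0 < e\<close> by simp
    also have "\<dots> = d" using N by (simp add: e_def field_simps)
    finally show ?thesis by simp
  qed
  then have "\<bar>?L - ?R\<bar> \<le> 0" by (rule field_le_epsilon)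
  then show ?thesis by simp
qed

lemma inverse_square_powr: "c \<le> t \<Longrightarrow> (1 / t\<^sup>2) powr (a / 2) = t powr (- a)"
  using c_pos
  by (simp add: powr_divide powr_powr powr_minus field_simps flip: powr_numeral)

lemma integral_negative_power_unique:
  assumes other: "positive_spectral_family E' D B c" and a: "0 < a"
  shows "(LINT t|\<mu> u. t powr (- a)) = (LINT t|scalar_spectral_measure E' u. t powr (- a))"
proof -
  interpret other: positive_spectral_family E' D B c by fact
  have "(LINT t|\<mu> u. t powr (- a)) = (LINT t|\<mu> u. (1 / t\<^sup>2) powr (a / 2))"
    using AE_ge_c[of u] by (intro integral_cong_AE) (auto elim!: eventually_mono simp: inverse_square_powr)
  also have "\<dots> = (LINT t|scalar_spectral_measure E' u. (1 / t\<^sup>2) powr (a / 2))"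
  proof (rule integral_continuous_unique[OF other])
    show "continuous_on {0..1 / c\<^sup>2} (\<lambda>s. s powr (a / 2))"
      using a by (intro continuous_on_powr' continuous_on_id continuous_on_const) auto
  qed simp
  also have "\<dots> = (LINT t|scalar_spectral_measure E' u. t powr (- a))"
    using other.AE_ge_c[of u] by (intro integral_cong_AE) (auto elim!: eventually_mono simp: inverse_square_powr)
  finally show ?thesis .
qed

lemma negative_power_bounded: "0 < a \<Longrightarrow> c \<le> t \<Longrightarrow> \<bar>t powr (- a)\<bar> \<le> c powr (- a)"
  using c_pos by (simp add: powr_mono2')

lemma in_spectral_domain_negative_power: "0 < a \<Longrightarrow> in_spectral_domain E (\<lambda>t. t powr (- a)) u"
  by (rule in_spectral_domain_bounded[where K = "c powr (- a)"]) (auto intro: negative_power_bounded[simplified])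

text \<open>Spectral integrals are characterised through integrals against \<open>\<mu> (u + y)\<close> and \<open>\<mu> (u - y)\<close>, and for
  \<open>t powr (- a)\<close>, which is bounded on the spectrum, the test vectors \<open>y\<close> range over the whole space.
  Independence of the integrals therefore gives independence of the operator.\<close>

lemma operator_power_negative_iff:
  assumes a: "0 < a"
  shows "operator_power D B (- a) u z \<longleftrightarrow> has_spectral_integral E (\<lambda>t. t powr (- a)) u z"
proof
  assume "operator_power D B (- a) u z"
  then obtain E' where E': "spectral_measure_of D B E'" and z: "has_spectral_integral E' (\<lambda>t. t powr (- a)) u z"
    by (auto simp: operator_power_def)
  interpret other: positive_spectral_family E' D B c
    using E' positive c_pos coercive by unfold_locales (auto simp: spectral_measure_of_def)
  show "has_spectral_integral E (\<lambda>t. t powr (- a)) u z"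
    using z in_spectral_domain_negative_power[OF a] other.in_spectral_domain_negative_power[OF a]
    by (simp add: has_spectral_integral_def integral_negative_power_unique[OF other.positive_spectral_family_axioms a])
next
  assume "has_spectral_integral E (\<lambda>t. t powr (- a)) u z"
  then show "operator_power D B (- a) u z"
    using spectral_measure by (auto simp: operator_power_def)
qed

text \<open>Testing against all vectors determines \<open>z\<close>, so the definite description in the norm denotes the
  value constructed from \<open>E\<close>.\<close>

lemma scale_norm_negative:
  assumes a: "0 < a"
  shows "(scale_norm D B (- a) u)\<^sup>2 = (LINT t|\<mu> u. (t powr (- a))\<^sup>2)"
proof -
  let ?f = "\<lambda>t::real. t powr (- a)"
  obtain z where z: "has_spectral_integral E ?f u z" "\<mu> z = density (\<mu> u) (\<lambda>t. ennreal ((?f t)\<^sup>2))"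
    by (rule has_spectral_integral_exists[OF _ in_spectral_domain_negative_power[OF a, of u]]) auto
  have "(THE z. operator_power D B (- a) u z) = z"
  proof (rule the_equality)
    show "operator_power D B (- a) u z" using z(1) by (simp add: operator_power_negative_iff[OF a])
    fix z' assume "operator_power D B (- a) u z'"
    then have "has_spectral_integral E ?f u z'" by (simp add: operator_power_negative_iff[OF a])
    moreover have "inner q v = ((LINT t|\<mu> (u + v). ?f t) - (LINT t|\<mu> (u - v). ?f t)) / 4"
      if "has_spectral_integral E ?f u q" for q v
      using that in_spectral_domain_negative_power[OF a, of v] unfolding has_spectral_integral_def by blast
    ultimately have "inner z' v = inner z v" for v using z(1) by metis
    then have "inner (z' - z) (z' - z) = 0" unfolding inner_diff_left[of z' z] by simp
    then show "z' = z" by simp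
  qed
  then have "(scale_norm D B (- a) u)\<^sup>2 = (LINT t|\<mu> z. 1)" by (simp add: scale_norm_def)
  also have "\<dots> = (LINT t|\<mu> u. (t powr (- a))\<^sup>2)"
    unfolding z(2) by (subst integral_density) auto
  finally show ?thesis .
qed

section \<open>Interpolation and spectral cut-off\<close>

lemma scale_norm_negative_sq:
  assumes a: "0 < a"
  shows "(scale_norm D B (- a) u)\<^sup>2 = (LINT t|\<mu> u. t powr (- 2 * a))"
proof -
  have "(t powr (- a))\<^sup>2 = t powr (- 2 * a)" for t :: real
    by (simp add: power2_eq_square flip: powr_add)
  then show ?thesis unfolding scale_norm_negative[OF a] by simp
qed

lemma integrable_negative_power: "0 < a \<Longrightarrow> integrable (\<mu> u) (\<lambda>t. t powr (- 2 * a))"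
  using negative_power_bounded[of "2 * a"] by (intro integrable_bounded_on_spectrum) auto

lemma scale_norm_diff_le:
  assumes a: "0 < a"
  shows "(scale_norm D B (- a) (u - v))\<^sup>2
    \<le> 2 * (scale_norm D B (- a) u)\<^sup>2 + 2 * (scale_norm D B (- a) v)\<^sup>2"
proof -
  have "(scale_norm D B (- a) (u + v))\<^sup>2 + (scale_norm D B (- a) (u - v))\<^sup>2
    = 2 * (scale_norm D B (- a) u)\<^sup>2 + 2 * (scale_norm D B (- a) v)\<^sup>2"
    unfolding scale_norm_negative_sq[OF a]
    by (rule integral_parallelogram) (simp_all add: integrable_negative_power[OF a, simplified])
  then show ?thesis using zero_le_power2[of "scale_norm D B (- a) (u + v)"] by linarith
qed

text \<open>Pointwise on the spectrum, either \<open>\<kappa> \<le> t\<close> and \<open>1 \<le> (t / \<kappa>) powr 2\<close>, or \<open>t \<le> \<kappa>\<close> and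
  \<open>1 \<le> (\<kappa> / t) powr (2 * a)\<close>.  Optimizing over \<open>\<kappa>\<close> would give the usual multiplicative
  interpolation inequality.\<close>

lemma interpolation_inequality:
  assumes a: "0 < a" and \<kappa>: "0 < \<kappa>" and u: "u \<in> D"
  shows "(norm u)\<^sup>2 \<le> \<kappa> powr (- 2) * (norm (B u))\<^sup>2 + \<kappa> powr (2 * a) * (scale_norm D B (- a) u)\<^sup>2"
proof -
  have i: "integrable (\<mu> u) (\<lambda>t. t\<^sup>2)" "integrable (\<mu> u) (\<lambda>t. t powr (- 2 * a))"
    using u by (simp only: D_iff) (rule integrable_negative_power[OF a])
  have "(norm u)\<^sup>2 = (LINT t|\<mu> u. 1)" by simp
  also have "\<dots> \<le> (LINT t|\<mu> u. \<kappa> powr (- 2) * t\<^sup>2 + \<kappa> powr (2 * a) * t powr (- 2 * a))"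
  proof (rule integral_mono_AE)
    show "integrable (\<mu> u) (\<lambda>t. \<kappa> powr (- 2) * t\<^sup>2 + \<kappa> powr (2 * a) * t powr (- 2 * a))"
      using i by (intro Bochner_Integration.integrable_add integrable_mult_right)
    show "AE t in \<mu> u. 1 \<le> \<kappa> powr (- 2) * t\<^sup>2 + \<kappa> powr (2 * a) * t powr (- 2 * a)"
      using AE_ge_c[of u]
    proof eventually_elim
      case (elim t)
      then have t: "0 < t" using c_pos by simp
      have e: "\<kappa> powr (- 2) * t\<^sup>2 = (t / \<kappa>) powr 2"
        "\<kappa> powr (2 * a) * t powr (- 2 * a) = (\<kappa> / t) powr (2 * a)"
        using t \<kappa> by (simp_all add: powr_mult inverse_powr powr_minus divide_inverse power_mult_distrib power_inverse)
      show ?case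
      proof (cases "\<kappa> \<le> t")
        case True
        then have "1 \<le> (t / \<kappa>) powr 2" using \<kappa> by (intro ge_one_powr_ge_zero) auto
        then show ?thesis unfolding e by (simp add: add_increasing2)
      next
        case False
        then have "1 \<le> (\<kappa> / t) powr (2 * a)" using a t by (intro ge_one_powr_ge_zero) auto
        then show ?thesis unfolding e by (simp add: add_increasing)
      qed
    qed
  qed (simp add: finite_measure.integrable_const)
  also have "\<dots> = \<kappa> powr (- 2) * (norm (B u))\<^sup>2 + \<kappa> powr (2 * a) * (scale_norm D B (- a) u)\<^sup>2"
    unfolding norm_B[OF u] scale_norm_negative_sq[OF a]
    using i by (subst Bochner_Integration.integral_add) auto
  finally show ?thesis .
qed

text \<open>The interval is bounded from below only to make it a bounded set; the spectrum is positive.\<close>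

definition cutoff :: "real \<Rightarrow> 'a \<Rightarrow> 'a" where
  "cutoff \<kappa> x = E {0..\<kappa>} x"

lemma cutoff_in_D: "cutoff \<kappa> x \<in> D"
  unfolding cutoff_def by (rule E_bounded_in_D) auto

lemma norm_B_cutoff_le:
  assumes p: "p < 1" and x: "integrable (\<mu> x) (\<lambda>t. t powr (2 * p))"
  shows "(norm (B (cutoff \<kappa> x)))\<^sup>2 \<le> \<kappa> powr (2 * (1 - p)) * (LINT t|\<mu> x. t powr (2 * p))"
proof -
  have "(norm (B (cutoff \<kappa> x)))\<^sup>2 = (LINT t|\<mu> x. indicator {0..\<kappa>} t * t\<^sup>2)"
    unfolding norm_B[OF cutoff_in_D] unfolding cutoff_def by (rule integral_\<mu>_E) auto
  also have "\<dots> \<le> (LINT t|\<mu> x. \<kappa> powr (2 * (1 - p)) * t powr (2 * p))"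
  proof (rule integral_mono_AE)
    show "integrable (\<mu> x) (\<lambda>t. indicator {0..\<kappa>} t * t\<^sup>2)"
      using cutoff_in_D[of \<kappa> x] unfolding D_iff cutoff_def
      by (rule integral_\<mu>_E(2)[THEN iffD1, rotated 2]) auto
    show "AE t in \<mu> x. indicator {0..\<kappa>} t * t\<^sup>2 \<le> \<kappa> powr (2 * (1 - p)) * t powr (2 * p)"
      using AE_ge_c[of x]
    proof eventually_elim
      case (elim t)
      then have t: "0 < t" using c_pos by simp
      have "t\<^sup>2 \<le> \<kappa> powr (2 * (1 - p)) * t powr (2 * p)" if "t \<le> \<kappa>"
      proof -
        have "t\<^sup>2 = t powr (2 * (1 - p)) * t powr (2 * p)"
          using t by (simp flip: powr_add)
        also have "\<dots> \<le> \<kappa> powr (2 * (1 - p)) * t powr (2 * p)"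
          using that t p by (intro mult_right_mono powr_mono2) auto
        finally show ?thesis .
      qed
      then show ?case by (auto simp: indicator_def)
    qed
  qed (use x in simp)
  also have "\<dots> = \<kappa> powr (2 * (1 - p)) * (LINT t|\<mu> x. t powr (2 * p))" by simp
  finally show ?thesis .
qed

text \<open>The error has spectrum in \<open>{\<kappa><..}\<close>, where \<open>t powr (- 2 * b)\<close> exceeds \<open>t powr (2 * p)\<close> by a factor of
  at most \<open>\<kappa> powr (- 2 * (b + p))\<close>.  The case \<open>b = 0\<close> is the error in the Hilbert space norm, the case
  \<open>b = a\<close> the one in the \<open>(- a)\<close>-norm.\<close>

lemma cutoff_error_le:
  assumes p: "0 < p" and b: "0 \<le> b" and \<kappa>: "0 < \<kappa>" and x: "integrable (\<mu> x) (\<lambda>t. t powr (2 * p))"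
  shows "(LINT t|\<mu> (cutoff \<kappa> x - x). t powr (- 2 * b))
    \<le> \<kappa> powr (- 2 * (b + p)) * (LINT t|\<mu> x. t powr (2 * p))"
proof -
  have "(LINT t|\<mu> (cutoff \<kappa> x - x). t powr (- 2 * b)) = (LINT t|\<mu> x. indicator (- {0..\<kappa>}) t * t powr (- 2 * b))"
    unfolding cutoff_def by (subst \<mu>_E_diff, simp, subst integral_density) auto
  also have "\<dots> \<le> (LINT t|\<mu> x. \<kappa> powr (- 2 * (b + p)) * t powr (2 * p))"
  proof (rule integral_mono_AE)
    have bd: "\<bar>indicator (- {0..\<kappa>}) t * t powr (- 2 * b)\<bar> \<le> \<kappa> powr (- 2 * b)" if "c \<le> t" for t
    proof (cases "t \<le> \<kappa>")
      case False
      then have "t powr (- 2 * b) \<le> \<kappa> powr (- 2 * b)" using \<kappa> b by (intro powr_mono2') auto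
      then show ?thesis by (simp add: indicator_def)
    qed (use that c_pos in \<open>simp add: indicator_def\<close>)
    show "integrable (\<mu> x) (\<lambda>t. indicator (- {0..\<kappa>}) t * t powr (- 2 * b))"
      by (rule integrable_bounded_on_spectrum[OF _ bd]) auto
    show "AE t in \<mu> x. indicator (- {0..\<kappa>}) t * t powr (- 2 * b) \<le> \<kappa> powr (- 2 * (b + p)) * t powr (2 * p)"
      using AE_ge_c[of x]
    proof eventually_elim
      case (elim t)
      then have t: "0 < t" using c_pos by simp
      have "t powr (- 2 * b) \<le> \<kappa> powr (- 2 * (b + p)) * t powr (2 * p)" if "\<kappa> < t"
      proof -
        have "t powr (- 2 * b) = t powr (- 2 * (b + p)) * t powr (2 * p)"
          by (simp add: algebra_simps flip: powr_add)
        also have "\<dots> \<le> \<kappa> powr (- 2 * (b + p)) * t powr (2 * p)"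
          using that \<kappa> p b by (intro mult_right_mono powr_mono2') auto
        finally show ?thesis .
      qed
      then show ?case using t by (auto simp: indicator_def)
    qed
  qed (use x in simp)
  also have "\<dots> = \<kappa> powr (- 2 * (b + p)) * (LINT t|\<mu> x. t powr (2 * p))" by simp
  finally show ?thesis .
qed

lemma norm_cutoff_error_le:
  assumes "0 < p" "0 < \<kappa>" "integrable (\<mu> x) (\<lambda>t. t powr (2 * p))"
  shows "(norm (cutoff \<kappa> x - x))\<^sup>2 \<le> \<kappa> powr (- 2 * p) * (LINT t|\<mu> x. t powr (2 * p))"
proof -
  have "(norm (cutoff \<kappa> x - x))\<^sup>2 = (LINT t|\<mu> (cutoff \<kappa> x - x). 1)" by simp
  also have "\<dots> = (LINT t|\<mu> (cutoff \<kappa> x - x). t powr (- 2 * 0))"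
    using AE_ge_c[of "cutoff \<kappa> x - x"] c_pos by (intro integral_cong_AE) (auto elim!: eventually_mono)
  also have "\<dots> \<le> \<kappa> powr (- 2 * p) * (LINT t|\<mu> x. t powr (2 * p))"
    using cutoff_error_le[OF assms(1) order_refl assms(2,3)] by simp
  finally show ?thesis .
qed

lemma scale_norm_cutoff_error_le:
  assumes "0 < a" "0 < p" "0 < \<kappa>" "integrable (\<mu> x) (\<lambda>t. t powr (2 * p))"
  shows "(scale_norm D B (- a) (cutoff \<kappa> x - x))\<^sup>2
    \<le> \<kappa> powr (- 2 * (a + p)) * (LINT t|\<mu> x. t powr (2 * p))"
  unfolding scale_norm_negative_sq[OF assms(1)] using assms by (intro cutoff_error_le) auto

section \<open>The error of the regularized solutions\<close>

lemma B_diff: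
  assumes "u \<in> D" "v \<in> D"
  shows "u - v \<in> D" "(norm (B (u - v)))\<^sup>2 \<le> 2 * (norm (B u))\<^sup>2 + 2 * (norm (B v))\<^sup>2"
proof -
  have i: "integrable (\<mu> u) (\<lambda>t. t\<^sup>2)" "integrable (\<mu> v) (\<lambda>t. t\<^sup>2)"
    using assms by (simp_all only: D_iff)
  have D: "u + v \<in> D" "u - v \<in> D"
    unfolding D_iff by (rule integral_parallelogram[OF _ i], simp)+
  show "u - v \<in> D" by fact
  have "(norm (B (u + v)))\<^sup>2 + (norm (B (u - v)))\<^sup>2 = 2 * (norm (B u))\<^sup>2 + 2 * (norm (B v))\<^sup>2"
    unfolding norm_B[OF D(1)] norm_B[OF D(2)] norm_B[OF assms(1)] norm_B[OF assms(2)]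
    by (rule integral_parallelogram[OF _ i]) simp
  then show "(norm (B (u - v)))\<^sup>2 \<le> 2 * (norm (B u))\<^sup>2 + 2 * (norm (B v))\<^sup>2"
    using zero_le_power2[of "norm (B (u + v))"] by linarith
qed

text \<open>The comparison with the cut-off at \<open>\<kappa> = \<delta> powr (- 1 / (p + a))\<close>, with \<open>m\<close> the \<open>p\<close>-norm of \<open>xd\<close>.  The
  condition on \<open>m * \<delta> powr (p / (p + a))\<close>, which holds for small \<open>\<delta>\<close>, puts the cut-off into the ball where
  the upper estimate for \<open>F\<close> is available.  The functional at the cut-off is at most \<open>(L * \<delta>)\<^sup>2\<close>.\<close>

lemma tikhonov_error_le:
  fixes F :: "'a \<Rightarrow> 'b::real_inner"
  assumes a: "0 < a" and p: "0 < p" "p < 1"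
    and xd: "integrable (\<mu> xd) (\<lambda>t. t powr (2 * p))"
    and m: "0 \<le> m" "m\<^sup>2 = (LINT t|\<mu> xd. t powr (2 * p))"
    and K: "0 < Klow" "0 \<le> Kup" and ball: "cball xd r \<subseteq> DF"
    and lower: "\<And>x. x \<in> DF \<inter> D \<Longrightarrow> Klow * scale_norm D B (- a) (x - xd) \<le> norm (F x - F xd)"
    and upper: "\<And>x. x \<in> cball xd r \<inter> D \<Longrightarrow> norm (F x - F xd) \<le> Kup * scale_norm D B (- a) (x - xd)"
    and \<delta>: "0 < \<delta>" "m * \<delta> powr (p / (p + a)) \<le> r" and noise: "norm (F xd - yd) \<le> \<delta>"
    and reg: "regularized_solution D B DF F yd (\<delta> powr (2 - 2 * ((p - 1) / (p + a)))) x"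
    and L: "L = Kup * m + 1 + m"
  shows "norm (x - xd) \<le> (2 * (L + 2 * m + (L + 1) / Klow) + m) * \<delta> powr (p / (p + a))"
proof -
  define \<kappa> where "\<kappa> = \<delta> powr (- 1 / (p + a))"
  define \<rho> where "\<rho> = \<delta> powr (p / (p + a))"
  define \<beta> where "\<beta> = \<delta> powr ((p - 1) / (p + a))"
  define \<alpha> where "\<alpha> = \<delta> powr (2 - 2 * ((p - 1) / (p + a)))"
  define N where "N v = scale_norm D B (- a) v" for v
  have pa: "0 < p + a" using a p by simp
  have pos: "0 < \<kappa>" "0 < \<rho>" "0 < \<beta>" "0 < \<alpha>"
    using \<delta>(1) by (simp_all add: \<kappa>_def \<rho>_def \<beta>_def \<alpha>_def)
  have sq: "(\<delta> powr q)\<^sup>2 = \<delta> powr (2 * q)" for q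
    by (simp add: power2_eq_square flip: powr_add)
  define s where "s = inverse (p + a)"
  have s: "s * p + s * a = 1" unfolding distrib_left[symmetric] s_def using pa by simp
  have \<delta>2: "\<delta>\<^sup>2 = \<delta> powr 2" using \<delta>(1) by simp
  \<comment> \<open>All quantities are powers of \<open>\<delta>\<close>: \<open>\<rho>\<close> is the rate and \<open>\<beta>\<close> the growth of \<open>\<parallel>B x\<^sub>\<kappa>\<parallel>\<close>.  The last three
    relations express the balance achieved by the choices of \<open>\<kappa>\<close> and \<open>\<alpha>\<close>.\<close>
  have rel1: "\<kappa> powr (2 * (1 - p)) = \<beta>\<^sup>2" and rel2: "\<kappa> powr (- 2 * p) = \<rho>\<^sup>2"
    and rel3: "\<kappa> powr (- 2 * (a + p)) = \<delta>\<^sup>2" and rel4: "\<kappa> powr (- 2) * \<beta>\<^sup>2 = \<rho>\<^sup>2"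
    and rel5: "\<kappa> powr (2 * a) * \<delta>\<^sup>2 = \<rho>\<^sup>2" and rel6: "\<alpha> * \<beta>\<^sup>2 = \<delta>\<^sup>2"
    unfolding \<kappa>_def \<rho>_def \<beta>_def \<alpha>_def sq \<delta>2 powr_powr powr_add[symmetric]
    divide_inverse s_def[symmetric]
    by (rule arg_cong[where f = "\<lambda>q. \<delta> powr q"], use s in \<open>simp add: algebra_simps\<close>)+
  define xk where "xk = cutoff \<kappa> xd"
  have xkD: "xk \<in> D" unfolding xk_def by (rule cutoff_in_D)
  have Bk: "(norm (B xk))\<^sup>2 \<le> (m * \<beta>)\<^sup>2"
    using norm_B_cutoff_le[OF p(2) xd, of \<kappa>] unfolding rel1 m(2)[symmetric] xk_def
    by (simp add: power_mult_distrib mult.commute)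
  have ek: "norm (xk - xd) \<le> m * \<rho>"
  proof (rule power2_le_imp_le)
    show "(norm (xk - xd))\<^sup>2 \<le> (m * \<rho>)\<^sup>2"
      using norm_cutoff_error_le[OF p(1) pos(1) xd] unfolding rel2 m(2)[symmetric] xk_def
      by (simp add: power_mult_distrib mult.commute)
  qed (use m pos in simp)
  have Nk: "N (xk - xd) \<le> m * \<delta>"
  proof (rule power2_le_imp_le)
    show "(N (xk - xd))\<^sup>2 \<le> (m * \<delta>)\<^sup>2"
      using scale_norm_cutoff_error_le[OF a p(1) pos(1) xd] unfolding rel3 m(2)[symmetric] xk_def N_def
      by (simp add: power_mult_distrib mult.commute)
  qed (use m \<delta> in simp)
  have xk_ball: "xk \<in> cball xd r"
    using ek \<delta>(2) by (simp add: dist_norm norm_minus_commute \<rho>_def)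
  then have xkDF: "xk \<in> DF" using ball by blast
  have "norm (F xk - yd) \<le> (Kup * m + 1) * \<delta>"
  proof -
    have "norm (F xk - yd) \<le> norm (F xk - F xd) + norm (F xd - yd)"
      using norm_triangle_ineq[of "F xk - F xd" "F xd - yd"] by simp
    also have "\<dots> \<le> Kup * (m * \<delta>) + \<delta>"
      using upper[of xk] xk_ball xkD noise Nk K(2) unfolding N_def
      by (intro add_mono) (auto intro: order_trans mult_left_mono)
    finally show ?thesis by (simp add: algebra_simps)
  qed
  then have "(norm (F xk - yd))\<^sup>2 + \<alpha> * (norm (B xk))\<^sup>2 \<le> ((Kup * m + 1) * \<delta>)\<^sup>2 + \<alpha> * (m * \<beta>)\<^sup>2"
    using pos by (intro add_mono power_mono mult_left_mono[OF Bk]) auto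
  also have "\<alpha> * (m * \<beta>)\<^sup>2 = (m * \<delta>)\<^sup>2"
    using rel6 by (simp add: power_mult_distrib)
  also have "((Kup * m + 1) * \<delta>)\<^sup>2 + (m * \<delta>)\<^sup>2 \<le> (L * \<delta>)\<^sup>2"
  proof -
    have "0 \<le> 2 * ((Kup * m + 1) * \<delta>) * (m * \<delta>)" using K m \<delta> by simp
    then show ?thesis unfolding L by (simp add: power2_eq_square algebra_simps)
  qed
  finally have Tk: "(norm (F xk - yd))\<^sup>2 + \<alpha> * (norm (B xk))\<^sup>2 \<le> (L * \<delta>)\<^sup>2" .
  have min: "x \<in> DF" "tikhonov D B F yd \<alpha> x \<le> tikhonov D B F yd \<alpha> xk"
    using reg xkDF unfolding regularized_solution_def is_arg_min_def \<alpha>_def by (auto simp: not_less)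
  then have xD: "x \<in> D" using xkD by (auto simp: tikhonov_def split: if_splits)
  have Tx: "(norm (F x - yd))\<^sup>2 + \<alpha> * (norm (B x))\<^sup>2 \<le> (L * \<delta>)\<^sup>2"
    using min(2) Tk xD xkD by (simp add: tikhonov_def)
  have L0: "0 \<le> L" using K m unfolding L by simp
  have Fx: "norm (F x - yd) \<le> L * \<delta>"
  proof (rule power2_le_imp_le)
    have "0 \<le> \<alpha> * (norm (B x))\<^sup>2" using pos by simp
    then show "(norm (F x - yd))\<^sup>2 \<le> (L * \<delta>)\<^sup>2" using Tx by linarith
  qed (use L0 \<delta> in simp)
  have Bx: "(norm (B x))\<^sup>2 \<le> (L * \<beta>)\<^sup>2"
  proof -
    have "\<alpha> * (norm (B x))\<^sup>2 \<le> (L * \<delta>)\<^sup>2" using Tx zero_le_power2[of "norm (F x - yd)"] by linarith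
    also have "\<dots> = \<alpha> * (L * \<beta>)\<^sup>2" by (simp add: power_mult_distrib rel6[symmetric])
    finally show ?thesis using pos by simp
  qed
  define Q where "Q = (L + 1) / Klow"
  have Q0: "0 \<le> Q" using L0 K by (simp add: Q_def)
  have Nx: "N (x - xd) \<le> Q * \<delta>"
  proof -
    have "Klow * N (x - xd) \<le> norm (F x - F xd)" unfolding N_def using lower[of x] min(1) xD by simp
    also have "\<dots> \<le> norm (F x - yd) + norm (yd - F xd)"
      using norm_triangle_ineq[of "F x - yd" "yd - F xd"] by simp
    also have "\<dots> \<le> (L + 1) * \<delta>" using Fx noise by (simp add: norm_minus_commute algebra_simps)
    finally show ?thesis using K by (simp add: Q_def field_simps)
  qed
  have N0: "0 \<le> N v" for v by (simp add: N_def scale_norm_def)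
  have "(norm (x - xk))\<^sup>2 \<le> \<kappa> powr (- 2) * (norm (B (x - xk)))\<^sup>2 + \<kappa> powr (2 * a) * (N (x - xk))\<^sup>2"
    unfolding N_def by (rule interpolation_inequality[OF a pos(1) B_diff(1)[OF xD xkD]])
  also have "\<dots> \<le> \<kappa> powr (- 2) * (2 * (L * \<beta>)\<^sup>2 + 2 * (m * \<beta>)\<^sup>2) + \<kappa> powr (2 * a) * (2 * (Q * \<delta>)\<^sup>2 + 2 * (m * \<delta>)\<^sup>2)"
  proof (intro add_mono mult_left_mono)
    show "(norm (B (x - xk)))\<^sup>2 \<le> 2 * (L * \<beta>)\<^sup>2 + 2 * (m * \<beta>)\<^sup>2"
      using B_diff(2)[OF xD xkD] Bx Bk by linarith
    have "(N (x - xk))\<^sup>2 \<le> 2 * (N (x - xd))\<^sup>2 + 2 * (N (xk - xd))\<^sup>2"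
      using scale_norm_diff_le[OF a, of "x - xd" "xk - xd"] by (simp add: N_def)
    also have "\<dots> \<le> 2 * (Q * \<delta>)\<^sup>2 + 2 * (m * \<delta>)\<^sup>2"
      using Nx Nk N0 by (intro add_mono mult_left_mono power_mono) auto
    finally show "(N (x - xk))\<^sup>2 \<le> 2 * (Q * \<delta>)\<^sup>2 + 2 * (m * \<delta>)\<^sup>2" .
  qed auto
  also have "\<dots> = (\<kappa> powr (- 2) * \<beta>\<^sup>2) * (2 * L\<^sup>2 + 2 * m\<^sup>2) + (\<kappa> powr (2 * a) * \<delta>\<^sup>2) * (2 * Q\<^sup>2 + 2 * m\<^sup>2)"
    by (simp add: power_mult_distrib algebra_simps)
  also have "\<dots> = (2 * L\<^sup>2 + 4 * m\<^sup>2 + 2 * Q\<^sup>2) * \<rho>\<^sup>2"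
    unfolding rel4 rel5 by (simp add: algebra_simps)
  also have "\<dots> \<le> (2 * (L + 2 * m + Q))\<^sup>2 * \<rho>\<^sup>2"
  proof (rule mult_right_mono)
    have "0 \<le> L * m" "0 \<le> L * Q" "0 \<le> m * Q" "0 \<le> L * L" "0 \<le> m * m" "0 \<le> Q * Q"
      using L0 m(1) Q0 by simp_all
    moreover have "(2 * (L + 2 * m + Q))\<^sup>2 - (2 * L\<^sup>2 + 4 * m\<^sup>2 + 2 * Q\<^sup>2)
      = 2 * (L * L) + 12 * (m * m) + 2 * (Q * Q) + 16 * (L * m) + 8 * (L * Q) + 16 * (m * Q)"
      by (simp add: power2_eq_square algebra_simps)
    ultimately show "2 * L\<^sup>2 + 4 * m\<^sup>2 + 2 * Q\<^sup>2 \<le> (2 * (L + 2 * m + Q))\<^sup>2" by linarith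
  qed simp
  finally have "(norm (x - xk))\<^sup>2 \<le> (2 * (L + 2 * m + Q) * \<rho>)\<^sup>2" by (simp add: power_mult_distrib)
  then have "norm (x - xk) \<le> 2 * (L + 2 * m + Q) * \<rho>"
    by (rule power2_le_imp_le) (use L0 m(1) Q0 pos in simp)
  then have "norm (x - xd) \<le> 2 * (L + 2 * m + Q) * \<rho> + m * \<rho>"
    using norm_triangle_ineq[of "x - xk" "xk - xd"] ek by simp
  then show ?thesis by (simp add: Q_def \<rho>_def algebra_simps)
qed

end

theorem proposition4:
  fixes D :: "'x::{real_inner, complete_space} set"
    and B :: "'x \<Rightarrow> 'x"
    and DF :: "'x set"
    and F :: "'x \<Rightarrow> 'y::{real_inner, complete_space}"
    and xd :: 'x and y :: 'y
    and a p r cB Klow Kup :: real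
  assumes "infinite_dimensional TYPE('x)" and "infinite_dimensional TYPE('y)"
    and "self_adjoint_on D B" and "unbounded_on D B" and "strictly_positive_on D B"
    and "cB > 0" and "\<And>x. x \<in> D \<Longrightarrow> norm (B x) \<ge> cB * norm x"
    and "DF \<inter> D \<noteq> {}"
    and "a > 0" and "0 < p" and "p < 1"
    and "xd \<in> hilbert_scale D B p" and "xd \<notin> hilbert_scale D B 1"
    and "weak_seq_continuous_on DF F" and "convex DF" and "closed DF"
    and "xd \<in> DF" and "F xd = y" and "\<And>x. x \<in> DF \<Longrightarrow> F x = y \<Longrightarrow> x = xd"
    and "r > 0" and "cball xd r \<subseteq> DF"
    and "0 < Klow" and "Klow \<le> Kup"
    and "\<And>x. x \<in> DF \<inter> hilbert_scale D B 1 \<Longrightarrow>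
           Klow * scale_norm D B (- a) (x - xd) \<le> norm (F x - F xd)"
    and "\<And>x. x \<in> cball xd r \<inter> hilbert_scale D B 1 \<Longrightarrow>
           norm (F x - F xd) \<le> Kup * scale_norm D B (- a) (x - xd)"
  shows "\<exists>C>0. \<exists>\<delta>0>0. \<forall>\<delta> y\<delta> x.
           0 < \<delta> \<longrightarrow> \<delta> \<le> \<delta>0 \<longrightarrow> norm (y - y\<delta>) \<le> \<delta> \<longrightarrow>
           regularized_solution D B DF F y\<delta> (\<delta> powr (2 - 2 * ((p - 1) / (p + a)))) x \<longrightarrow>
           norm (x - xd) \<le> C * \<delta> powr (p / (p + a))"
proof -
  obtain E z where E: "spectral_measure_of D B E" and z: "has_spectral_integral E (\<lambda>t. t powr p) xd z"
    using \<open>xd \<in> hilbert_scale D B p\<close> by (auto simp: hilbert_scale_def operator_power_def)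
  interpret positive_spectral_family E D B cB
    using E assms(5-7) by unfold_locales (auto simp: spectral_measure_of_def)
  have sq: "(t powr p)\<^sup>2 = t powr (2 * p)" for t :: real
    by (simp add: power2_eq_square flip: powr_add)
  have xd: "integrable (\<mu> xd) (\<lambda>t. t powr (2 * p))"
    using z unfolding has_spectral_integral_def in_spectral_domain_def sq by blast
  define m where "m = sqrt (LINT t|\<mu> xd. t powr (2 * p))"
  have m: "0 \<le> m" "m\<^sup>2 = (LINT t|\<mu> xd. t powr (2 * p))"
    by (simp_all add: m_def Bochner_Integration.integral_nonneg)
  define L where "L = Kup * m + 1 + m"
  define C where "C = 2 * (L + 2 * m + (L + 1) / Klow) + m"
  \<comment> \<open>The largest noise level with \<open>\<delta> powr (p / (p + a)) \<le> r / (m + 1)\<close>; the 1 avoids division by 0.\<close>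
  define \<delta>0 where "\<delta>0 = (r / (m + 1)) powr ((p + a) / p)"
  have L: "0 < L"
    using m assms(22,23) by (simp add: L_def add_pos_nonneg add_nonneg_pos)
  have "0 < C"
    unfolding C_def using L m(1) assms(22) by (intro add_pos_nonneg mult_pos_pos) auto
  moreover have "0 < \<delta>0" using \<open>r > 0\<close> m by (simp add: \<delta>0_def add_nonneg_pos)
  moreover have "norm (x - xd) \<le> C * \<delta> powr (p / (p + a))"
    if \<delta>: "0 < \<delta>" "\<delta> \<le> \<delta>0" and noise: "norm (y - y\<delta>) \<le> \<delta>"
      and reg: "regularized_solution D B DF F y\<delta> (\<delta> powr (2 - 2 * ((p - 1) / (p + a)))) x"
    for \<delta> y\<delta> x
  proof -
    have small: "m * \<delta> powr (p / (p + a)) \<le> r"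
    proof -
      have "\<delta> powr (p / (p + a)) \<le> \<delta>0 powr (p / (p + a))"
        using \<delta> assms(9,10) by (intro powr_mono2) auto
      also have "\<dots> = r / (m + 1)"
        using assms(9,10) \<open>r > 0\<close> m by (simp add: \<delta>0_def powr_powr)
      finally have "m * \<delta> powr (p / (p + a)) \<le> m * (r / (m + 1))"
        using m by (intro mult_left_mono)
      also have "\<dots> \<le> r" using m \<open>r > 0\<close> by (simp add: field_simps)
      finally show ?thesis .
    qed
    show ?thesis
      unfolding C_def
    proof (rule tikhonov_error_le[OF assms(9-11) xd m assms(22) _ assms(21) _ _ \<delta>(1) small _ reg L_def])
      show "0 \<le> Kup" using assms(22,23) by simp
      show "norm (F xd - y\<delta>) \<le> \<delta>" using noise assms(18) by simp
    qed (use assms(24,25) hilbert_scale_1 in auto)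
  qed
  ultimately show ?thesis by blast
qed

end
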